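(* Let $(f,X,\mu)$ be a conservative, ergodic dynamical system on a metric space $X$ preserving a $\sigma$-finite measure $\mu$ with $\mu(X)=\infty$. Let $(f_Y,Y,\mu_Y)$ be the induced system over a domain $Y\subseteq X$ of finite positive measure, preserving a probability measure $\mu_Y=\mu|_Y$, with return time function $R\colon Y\to\mathbb{N}$. Suppose $R$ has regular suplevels (with respect to $(f_Y,Y,\mu_Y)$) with associated exponent $\alpha_R>0$, and that $(f_Y,Y,\mu_Y)$ satisfies condition (SPDC). Let $B_n\subseteq Y$ be a decreasing sequence of targets satisfying items (i) and (ii) of the definition of regular suplevels (with $B_n$ in place of $A_n$), and let $\alpha\ge0$ be such that $\alpha=\lim_{n\to\infty}\frac{\log\mu(B_n)}{-\log n}$. Then for $\mu$-a.e. $x\in X$, $$\lim_{n\to\infty}\frac{\log\tau(f,x,B_n)}{\log n}=\frac{\alpha}{\alpha_R},$$ where $\tau(f,x,B_n)=\min\{m\ge0:f^m(x)\in B_n\}$.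
   Context: Induced system: $R(x)=\min\{n>0:f^n(x)\in Y\}$ for $x\in Y$, and $f_Y(x)=f^{R(x)}(x)$. Regular suplevels of an unbounded function $\phi\colon Z\to[0,\infty)$ on a metric measure space $(Z,m)$: put $A_n=\{x\in Z:\phi(x)\ge n\}$. Then (i) $\lim_{n\to\infty}m(A_n)=0$; there is $c>0$ such that $m(A_{n+1})>c\,m(A_n)$ for all sufficiently large $n$; and there is $\alpha_\phi\in[0,\infty)$ (the associated exponent) with $\alpha_\phi=\lim_{n\to\infty}\frac{\log m(A_n)}{-\log n}$; (ii) there are $\beta\ge0$ and a Lipschitz function $\tilde\phi\colon Z\to\mathbb{R}^+$ (nonnegative values) such that $A_n=\{x\in Z:\tilde\phi(x)\le(m(A_n))^\beta\}$. Here this is applied with $Z=Y$, $m=\mu_Y$. For the targets: $\mu(B_n)\to0$, $\mu(B_{n+1})>c\,\mu(B_n)$ eventually for some $c>0$, the limit $\alpha$ exists, and there are $\beta\ge 0$ and a Lipschitz $g\colon Y\to\mathbb{R}^+$ with $B_n=\{x\in Y:g(x)\le\mu(B_n)^\beta\}$. Condition (SPDC) for a probability preserving system $(T,Z,m)$ on a metric space: there is $\Theta(n)$ with $\lim_{n\to\infty}n^{a}\Theta(n)=0$ for every $a>0$ such that for all Lipschitz $\varphi,\psi\colon Z\to\mathbb{R}$ and all $n$, $\left|\int\varphi\circ T^n\,\psi\,dm-\int\varphi\,dm\int\psi\,dm\right|\le\|\varphi\|\|\psi\|\Theta(n)$, with $\|\cdot\|$ the usual Lipschitz norm. *)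

theory Defs
  imports "HOL-Analysis.Analysis"
begin

definition preserves_measure :: "('a \<Rightarrow> 'a) \<Rightarrow> 'a measure \<Rightarrow> bool" where
  "preserves_measure f M \<longleftrightarrow> f \<in> measurable M M \<and> distr M M f = M"

text \<open>Every wandering set (a measurable set whose preimages are pairwise disjoint) is null.\<close>

definition conservative :: "('a \<Rightarrow> 'a) \<Rightarrow> 'a measure \<Rightarrow> bool" where
  "conservative f M \<longleftrightarrow>
     (\<forall>W\<in>sets M. disjoint_family (\<lambda>n::nat. (f ^^ n) -` W \<inter> space M) \<longrightarrow> emeasure M W = 0)"

definition ergodic :: "('a \<Rightarrow> 'a) \<Rightarrow> 'a measure \<Rightarrow> bool" where
  "ergodic f M \<longleftrightarrow>
     (\<forall>A\<in>sets M. f -` A \<inter> space M = A \<longrightarrow> emeasure M A = 0 \<or> emeasure M (space M - A) = 0)"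

text \<open>
  The return time is finite at every point of \<open>Y\<close> in the intended setting. For points that never
  return (a null set if the system is conservative) it is set to \<open>0\<close>, so that
  the induced map fixes them and always maps \<open>Y\<close> to itself.
\<close>

definition return_time :: "('a \<Rightarrow> 'a) \<Rightarrow> 'a set \<Rightarrow> 'a \<Rightarrow> nat" where
  "return_time f Y x =
     (if \<exists>n>0. (f ^^ n) x \<in> Y then LEAST n. n > 0 \<and> (f ^^ n) x \<in> Y else 0)"

definition induced_map :: "('a \<Rightarrow> 'a) \<Rightarrow> 'a set \<Rightarrow> 'a \<Rightarrow> 'a" where
  "induced_map f Y x = (f ^^ return_time f Y x) x"

text \<open>The normalised restriction of \<open>M\<close> to \<open>Y\<close>, as a measure with underlying space \<open>Y\<close>.\<close>

definition induced_measure :: "'a measure \<Rightarrow> 'a set \<Rightarrow> 'a measure" where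
  "induced_measure M Y = uniform_measure (restrict_space M Y) Y"

definition regular_decay :: "'a measure \<Rightarrow> (nat \<Rightarrow> 'a set) \<Rightarrow> real \<Rightarrow> bool" where
  "regular_decay m A \<alpha> \<longleftrightarrow>
     (\<lambda>n. measure m (A n)) \<longlonglongrightarrow> 0 \<and>
     (\<exists>c>0. \<forall>\<^sub>F n in sequentially. measure m (A (Suc n)) > c * measure m (A n)) \<and>
     \<alpha> \<ge> 0 \<and>
     (\<lambda>n. ln (measure m (A n)) / (- ln (real n))) \<longlonglongrightarrow> \<alpha>"

definition lipschitz_sublevels ::
  "'a::metric_space measure \<Rightarrow> 'a set \<Rightarrow> (nat \<Rightarrow> 'a set) \<Rightarrow> bool" where
  "lipschitz_sublevels m Z A \<longleftrightarrow>
     (\<exists>\<beta>\<ge>0. \<exists>g::'a \<Rightarrow> real. (\<exists>L. L-lipschitz_on Z g) \<and> (\<forall>x\<in>Z. g x \<ge> 0) \<and>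
        (\<forall>n\<ge>1. A n = {x\<in>Z. g x \<le> measure m (A n) powr \<beta>}))"

definition regular_suplevels :: "'a::metric_space measure \<Rightarrow> ('a \<Rightarrow> real) \<Rightarrow> real \<Rightarrow> bool" where
  "regular_suplevels m \<phi> \<alpha> \<longleftrightarrow>
     (\<forall>x\<in>space m. \<phi> x \<ge> 0) \<and> \<not> bdd_above (\<phi> ` space m) \<and>
     (let A = \<lambda>n. {x\<in>space m. \<phi> x \<ge> real n}
      in regular_decay m A \<alpha> \<and> lipschitz_sublevels m (space m) A)"

text \<open>
  Supremum norm plus best Lipschitz constant; meaningful for nonempty \<open>Z\<close> and bounded Lipschitz
  functions on it. Unbounded Lipschitz functions have infinite norm and impose no condition on
  the decay of correlations.
\<close>

definition lipschitz_norm :: "'a::metric_space set \<Rightarrow> ('a \<Rightarrow> real) \<Rightarrow> real" where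
  "lipschitz_norm Z \<phi> = (SUP x\<in>Z. \<bar>\<phi> x\<bar>) + Inf {L. L-lipschitz_on Z \<phi>}"

definition bounded_lipschitz :: "'a::metric_space set \<Rightarrow> ('a \<Rightarrow> real) \<Rightarrow> bool" where
  "bounded_lipschitz Z \<phi> \<longleftrightarrow> bounded (\<phi> ` Z) \<and> (\<exists>L. L-lipschitz_on Z \<phi>)"

definition SPDC :: "('a::metric_space \<Rightarrow> 'a) \<Rightarrow> 'a measure \<Rightarrow> bool" where
  "SPDC T m \<longleftrightarrow>
     (\<exists>\<Theta>::nat \<Rightarrow> real.
        (\<forall>a>0. (\<lambda>n. real n powr a * \<Theta> n) \<longlonglongrightarrow> 0) \<and>
        (\<forall>\<phi> \<psi>. bounded_lipschitz (space m) \<phi> \<longrightarrow> bounded_lipschitz (space m) \<psi> \<longrightarrow>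
           (\<forall>n. \<bar>(\<integral>x. \<phi> ((T ^^ n) x) * \<psi> x \<partial>m) - (\<integral>x. \<phi> x \<partial>m) * (\<integral>x. \<psi> x \<partial>m)\<bar>
                \<le> lipschitz_norm (space m) \<phi> * lipschitz_norm (space m) \<psi> * \<Theta> n)))"

text \<open>The infimum over the empty set is \<open>\<infinity>\<close>: the orbit never meets \<open>B\<close>.\<close>

definition hitting_time :: "('a \<Rightarrow> 'a) \<Rightarrow> 'a \<Rightarrow> 'a set \<Rightarrow> enat" where
  "hitting_time f x B = (INF m\<in>{m. (f ^^ m) x \<in> B}. enat m)"

definition ln_enat :: "enat \<Rightarrow> ereal" where
  "ln_enat t = (case t of enat k \<Rightarrow> if k = 0 then - \<infinity> else ereal (ln (real k)) | \<infinity> \<Rightarrow> \<infinity>)"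

end

theory Submission
  imports Defs "HOL-Probability.Probability_Measure" "HOL-Real_Asymp.Real_Asymp"
begin

text \<open>
  Cut the orbit of \<open>x\<close> under \<open>f\<close> at its visits to \<open>Y\<close>. The \<open>k\<close>-th visit is the point
  \<open>f\<^sub>Y\<^sup>k x\<close>, and it happens at the time \<open>S\<^sub>k x = (\<Sum>j<k. R (f\<^sub>Y\<^sup>j x))\<close>. As all targets lie
  in \<open>Y\<close>, the hitting time of \<open>B n\<close> under \<open>f\<close> is \<open>S\<close> evaluated at the hitting time of \<open>B n\<close>
  under \<open>f\<^sub>Y\<close>. So the exponent \<open>\<alpha> / \<alpha>\<^sub>R\<close> is the product of two exponents of the
  probability preserving system \<open>f\<^sub>Y\<close>: its hitting time of \<open>B n\<close> is \<open>n\<close> to the power \<open>\<alpha>\<close>, and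
  \<open>S\<^sub>k\<close> is \<open>k\<close> to the power \<open>1 / \<alpha>\<^sub>R\<close>, both up to arbitrarily small powers.

  Hitting times. A set of measure \<open>n\<close> to the power \<open>-\<alpha>\<close> is rarely met before time \<open>n\<close> to the power
  \<open>\<theta> < \<alpha>\<close>, by the union bound (\<open>AE_eventually_no_early_hit\<close>). That it is met before a power above
  \<open>\<alpha>\<close> is a second moment argument (\<open>prob_no_hit_le\<close>, \<open>AE_eventually_hit\<close>). The orbit is sampled
  only at multiples of \<open>D\<close>, a small power of \<open>n\<close>, and the indicator of the target is replaced by
  a Lipschitz function below it. The Lipschitz constant grows polynomially in \<open>n\<close>, whereas the
  correlations at distance \<open>D\<close> or more decay faster than any power of \<open>n\<close>, so the samples behave
  like pairwise independent ones. Both bounds are summable along \<open>n = 2\<^sup>i\<close>, and monotonicity of the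
  targets fills the gaps between powers of two.

  Return times. The lower bound on \<open>S\<^sub>k\<close> is the same hitting statement for the targets
  \<open>{R \<ge> n}\<close>: once the orbit has met this set, one summand already reaches \<open>n\<close>. For
  the upper bound, \<open>\<mu>(X) = \<infinity>\<close> and Kac's formula give \<open>\<integral>R = \<infinity>\<close> (\<open>not_summable_return_tails\<close>), whence
  \<open>\<alpha>\<^sub>R \<le> 1\<close>. Therefore the power \<open>p\<close> is subadditive for each \<open>p < \<alpha>\<^sub>R\<close>, the moment of \<open>R\<close> of
  order \<open>p\<close> is finite, and Markov's inequality for \<open>S\<^sub>k\<close> to the power \<open>p\<close> is summable along powers
  of two (\<open>AE_eventually_birkhoff_sum_le\<close>).

  Conservativity makes \<open>f\<^sub>Y\<close> defined and measure preserving almost everywhere; together with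
  ergodicity it brings almost every orbit into \<open>Y\<close>, and a finite delay does not change the exponent.
\<close>

section \<open>Almost sure statements along a dyadic scale\<close>

text \<open>A power-law bound is in general not summable over all \<open>n\<close>, but over powers of two it is
  geometric. This is why the almost sure estimates below are first obtained for \<open>n = 2\<^sup>i\<close>.\<close>
lemma AE_eventually_avoids_dyadic:
  fixes E :: "nat \<Rightarrow> 'a set" and C e :: real
  assumes fin: "finite_measure m" and meas: "\<And>n. E n \<in> sets m"
    and e: "e > 0" and decay: "\<forall>\<^sub>F n in sequentially. measure m (E n) \<le> C * real n powr (-e)"
  shows "AE x in m. \<forall>\<^sub>F i in sequentially. x \<notin> E (2 ^ i)"
proof -
  interpret finite_measure m by (rule fin)
  have lim: "filterlim (\<lambda>i::nat. 2 ^ i :: nat) at_top sequentially"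
    by (rule filterlim_at_top_mono[OF filterlim_ident])
       (auto intro!: always_eventually less_imp_le less_exp)
  have "\<forall>\<^sub>F i in sequentially. norm (measure m (E (2 ^ i))) \<le> C * (2 powr (-e)) ^ i"
    using eventually_compose_filterlim[OF decay lim]
    by eventually_elim (simp add: powr_power powr_powr mult.commute flip: powr_realpow)
  moreover have "summable (\<lambda>i. C * (2 powr (-e)) ^ i)"
    using e by (intro summable_mult summable_geometric) (simp add: powr_less_one)
  ultimately have "summable (\<lambda>i. measure m (E (2 ^ i)))"
    by (rule summable_comparison_test_ev)
  then have "AE x in m. \<forall>\<^sub>F i in sequentially. x \<in> space m - E (2 ^ i)"
    using meas by (intro borel_cantelli_AE1) (auto simp: less_top[symmetric])
  then show ?thesis
    by eventually_elim (auto elim: eventually_mono)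
qed

text \<open>The interpolation device: an arbitrary \<open>n\<close> lies between a power of two \<open>k\<close> and \<open>2 * k\<close>, and
  a quantity monotone in \<open>n\<close> is controlled by its values there at the cost of a constant factor.\<close>
lemma eventually_dyadic_bracket:
  fixes P :: "nat \<Rightarrow> bool"
  assumes "\<forall>\<^sub>F i in sequentially. P (2 ^ i)"
  shows "\<forall>\<^sub>F n in sequentially. \<exists>k>0. P k \<and> P (2 * k) \<and> k \<le> n \<and> n < 2 * k"
proof -
  obtain i0 where i0: "\<And>i. i \<ge> i0 \<Longrightarrow> P (2 ^ i)"
    using assms by (auto simp: eventually_sequentially)
  show ?thesis
    unfolding eventually_sequentially
  proof (rule exI[of _ "2 ^ i0"], intro allI impI)
    fix n :: nat assume n: "2 ^ i0 \<le> n"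
    then have "n > 0" by (meson less_le_trans zero_less_numeral zero_less_power)
    then obtain i where i: "2 ^ i \<le> n" "n < 2 ^ (i + 1)"
      using ex_power_ivl1[of 2 n] by auto
    have "i0 \<le> i"
      using n i power_less_imp_less_exp[of 2 i0 "i + 1"]
      by (metis Suc_eq_plus1 le_less_trans less_Suc_eq_le one_less_numeral_iff semiring_norm(76))
    then show "\<exists>k>0. P k \<and> P (2 * k) \<and> k \<le> n \<and> n < 2 * k"
      using i i0[of i] i0[of "Suc i"] by (intro exI[of _ "2 ^ i"]) auto
  qed
qed

text \<open>Exchanges the uncountable quantifier over exponents with the almost sure one: a sequence of
  exponents tending to \<open>a\<close> suffices by monotonicity.\<close>
lemma AE_all_greater:
  fixes a :: real
  assumes ae: "\<And>b. b > a \<Longrightarrow> AE x in m. P b x"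
    and mono: "\<And>b c x. a < b \<Longrightarrow> b \<le> c \<Longrightarrow> P b x \<Longrightarrow> P c x"
  shows "AE x in m. \<forall>b>a. P b x"
proof -
  have "AE x in m. \<forall>i. P (a + inverse (real (Suc i))) x"
    by (simp only: AE_all_countable) (auto intro: ae)
  then show ?thesis
  proof eventually_elim
    case (elim x)
    show ?case
    proof (intro allI impI)
      fix b assume "b > a"
      then obtain i where "inverse (real (Suc i)) < b - a"
        using reals_Archimedean[of "b - a"] by auto
      then have "a + inverse (real (Suc i)) \<le> b" by simp
      moreover have "P (a + inverse (real (Suc i))) x" using elim by blast
      moreover have "a < a + inverse (real (Suc i))" by simp
      ultimately show "P b x" using mono by blast
    qed
  qed
qed

lemma AE_all_less:
  fixes a :: real
  assumes ae: "\<And>b. b < a \<Longrightarrow> AE x in m. P b x"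
    and mono: "\<And>b c x. c < a \<Longrightarrow> b \<le> c \<Longrightarrow> P c x \<Longrightarrow> P b x"
  shows "AE x in m. \<forall>b<a. P b x"
proof -
  have "AE x in m. \<forall>b>-a. P (- b) x"
  proof (rule AE_all_greater[where P = "\<lambda>b. P (- b)" and a = "- a"])
    show "AE x in m. P (- b) x" if "b > - a" for b
      using that by (intro ae) simp
    show "P (- c) x" if "- a < b" "b \<le> c" "P (- b) x" for b c x
    proof (rule mono)
      show "- b < a" "- c \<le> - b" "P (- b) x" using that by auto
    qed
  qed
  then show ?thesis
  proof eventually_elim
    case (elim x)
    show ?case
    proof (intro allI impI)
      fix b assume "b < a"
      with elim[rule_format, of "- b"] show "P b x" by simp
    qed
  qed
qed

lemma eventually_powr_mono:
  fixes b c :: real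
  assumes "b \<le> c"
  shows "\<forall>\<^sub>F n in sequentially. real n powr b \<le> real n powr c"
  using eventually_ge_at_top[of 1]
  by eventually_elim (use assms in \<open>auto intro: powr_mono\<close>)

section \<open>Iterates of a measure preserving map\<close>

lemma preserves_measure_funpow:
  assumes "preserves_measure T m"
  shows "preserves_measure (T ^^ n) m"
proof (induction n)
  case 0
  have "distr m m (\<lambda>x. x) = m" by (rule distr_id)
  then show ?case by (auto simp: preserves_measure_def id_def)
next
  case (Suc n)
  have "distr m m (T \<circ> T ^^ n) = distr (distr m m (T ^^ n)) m T"
    using Suc assms by (subst distr_distr) (auto simp: preserves_measure_def)
  then show ?case
    using Suc assms
    by (auto simp: preserves_measure_def o_def intro: measurable_comp[unfolded o_def])
qed

lemma measure_vimage_funpow: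
  assumes "preserves_measure T m" "A \<in> sets m"
  shows "measure m ((T ^^ n) -` A \<inter> space m) = measure m A"
proof -
  have "measure m A = measure (distr m m (T ^^ n)) A"
    using preserves_measure_funpow[OF assms(1), of n] by (simp add: preserves_measure_def)
  also have "\<dots> = measure m ((T ^^ n) -` A \<inter> space m)"
    using preserves_measure_funpow[OF assms(1), of n] assms(2)
    by (intro measure_distr) (auto simp: preserves_measure_def)
  finally show ?thesis ..
qed

lemma integral_funpow:
  fixes h :: "'a \<Rightarrow> real"
  assumes "preserves_measure T m" "h \<in> borel_measurable m"
  shows "(\<integral>x. h ((T ^^ n) x) \<partial>m) = (\<integral>x. h x \<partial>m)"
proof -
  have "(\<integral>x. h x \<partial>m) = (\<integral>x. h x \<partial>(distr m m (T ^^ n)))"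
    using preserves_measure_funpow[OF assms(1), of n] by (simp add: preserves_measure_def)
  also have "\<dots> = (\<integral>x. h ((T ^^ n) x) \<partial>m)"
    using preserves_measure_funpow[OF assms(1), of n] assms(2)
    by (intro integral_distr) (auto simp: preserves_measure_def)
  finally show ?thesis ..
qed

lemma nn_integral_funpow:
  assumes "preserves_measure T m" "h \<in> borel_measurable m"
  shows "(\<integral>\<^sup>+x. h ((T ^^ n) x) \<partial>m) = (\<integral>\<^sup>+x. h x \<partial>m)"
proof -
  have "(\<integral>\<^sup>+x. h x \<partial>m) = (\<integral>\<^sup>+x. h x \<partial>(distr m m (T ^^ n)))"
    using preserves_measure_funpow[OF assms(1), of n] by (simp add: preserves_measure_def)
  also have "\<dots> = (\<integral>\<^sup>+x. h ((T ^^ n) x) \<partial>m)"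
    using preserves_measure_funpow[OF assms(1), of n] assms(2)
    by (intro nn_integral_distr) (auto simp: preserves_measure_def)
  finally show ?thesis ..
qed

section \<open>Early visits to shrinking targets\<close>

text \<open>Union bound: by invariance, about \<open>n\<close> to the power \<open>\<theta>\<close> preimages of \<open>A n\<close> have total measure at
  most of order \<open>n\<close> to the power \<open>\<theta> - b\<close>.\<close>
lemma AE_eventually_no_early_hit:
  fixes A :: "nat \<Rightarrow> 'a set" and b \<theta> :: real
  assumes prob: "prob_space m" and inv: "preserves_measure T m"
    and meas: "\<And>n. n \<ge> 1 \<Longrightarrow> A n \<in> sets m"
    and dec: "\<And>n k. 1 \<le> n \<Longrightarrow> n \<le> k \<Longrightarrow> A k \<subseteq> A n"
    and decay: "\<forall>\<^sub>F n in sequentially. measure m (A n) \<le> real n powr (-b)"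
    and \<theta>: "0 \<le> \<theta>" "\<theta> < b"
  shows "AE x in m. \<forall>\<^sub>F n in sequentially. \<forall>k. real k < real n powr \<theta> \<longrightarrow> (T ^^ k) x \<notin> A n"
proof -
  interpret prob_space m by (rule prob)
  \<comment> \<open>The time window at scale \<open>N\<close> is the one for \<open>2 * N\<close>, so that it serves all \<open>n\<close> between.\<close>
  define K where "K n = nat \<lceil>(2 * real n) powr \<theta>\<rceil>" for n
  define E where "E n = (\<Union>k<K n. (T ^^ k) -` A (max 1 n) \<inter> space m)" for n
  have Tk [measurable]: "T ^^ k \<in> m \<rightarrow>\<^sub>M m" for k
    using preserves_measure_funpow[OF inv] by (simp add: preserves_measure_def)
  have E: "E n \<in> sets m" for n
    unfolding E_def by (intro sets.finite_UN finite_lessThan measurable_sets[OF Tk] meas) auto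
  have "\<forall>\<^sub>F n in sequentially. measure m (E n) \<le> (2 powr \<theta> + 1) * real n powr (-(b - \<theta>))"
    using decay eventually_ge_at_top[of 1]
  proof eventually_elim
    case (elim n)
    have "measure m (E n) \<le> (\<Sum>k<K n. measure m ((T ^^ k) -` A (max 1 n) \<inter> space m))"
      unfolding E_def
      by (intro finite_measure_subadditive_finite) (auto intro!: measurable_sets[OF Tk] meas)
    also have "\<dots> = real (K n) * measure m (A n)"
      using elim by (simp add: measure_vimage_funpow[OF inv meas] max_def)
    also have "\<dots> \<le> ((2 powr \<theta> + 1) * real n powr \<theta>) * real n powr (-b)"
    proof (intro mult_mono elim)
      have "real (K n) \<le> (2 * real n) powr \<theta> + 1"
        unfolding K_def using powr_ge_zero[of "2 * real n" \<theta>] by linarith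
      also have "1 \<le> real n powr \<theta>" using elim \<theta> by (simp add: ge_one_powr_ge_zero)
      finally show "real (K n) \<le> (2 powr \<theta> + 1) * real n powr \<theta>"
        by (simp add: powr_mult algebra_simps)
    qed auto
    also have "\<dots> = (2 powr \<theta> + 1) * real n powr (-(b - \<theta>))"
      by (simp add: powr_add[symmetric])
    finally show ?case .
  qed
  then have "AE x in m. \<forall>\<^sub>F i in sequentially. x \<notin> E (2 ^ i)"
    using \<theta> E by (intro AE_eventually_avoids_dyadic[of m E "b - \<theta>"]) (auto intro: finite_measure)
  then show ?thesis
    using AE_space
  proof eventually_elim
    case (elim x)
    show ?case
      using eventually_dyadic_bracket[OF elim(1)]
    proof eventually_elim
      case (elim n)
      then obtain N where N: "N > 0" "x \<notin> E N" "N \<le> n" "n < 2 * N" by blast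
      show ?case
      proof (intro allI impI)
        fix k assume k: "real k < real n powr \<theta>"
        have "real n powr \<theta> \<le> (2 * real N) powr \<theta>"
          using N \<theta> by (intro powr_mono2) auto
        with k have "k < K N" unfolding K_def by linarith
        with N(2) \<open>x \<in> space m\<close> have "(T ^^ k) x \<notin> A (max 1 N)" by (auto simp: E_def)
        moreover have "A n \<subseteq> A (max 1 N)" using N by (intro dec) auto
        ultimately show "(T ^^ k) x \<notin> A n" by auto
      qed
    qed
  qed
qed

text \<open>Replaces the previous lemma when the measures decay slower than any power (exponent \<open>0\<close>): the
  point still is not in the target at time \<open>0\<close>, which keeps the logarithm of the hitting
  time nonnegative.\<close>
lemma AE_eventually_leaves:
  assumes prob: "prob_space m"
    and meas: "\<And>n. n \<ge> 1 \<Longrightarrow> A n \<in> sets m"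
    and dec: "\<And>n k. 1 \<le> n \<Longrightarrow> n \<le> k \<Longrightarrow> A k \<subseteq> A n"
    and lim: "(\<lambda>n. measure m (A n)) \<longlonglongrightarrow> 0"
  shows "AE x in m. \<forall>\<^sub>F n in sequentially. x \<notin> A n"
proof -
  interpret prob_space m by (rule prob)
  define N where "N = (\<Inter>n. A (Suc n))"
  have "range (\<lambda>n. A (Suc n)) \<subseteq> sets m" using meas by auto
  then have N: "N \<in> sets m" unfolding N_def by (rule sets.countable_INT) auto
  have "measure m N \<le> measure m (A (Suc n))" for n
    using meas[of "Suc n"] by (intro finite_measure_mono) (auto simp: N_def)
  then have "measure m N \<le> 0"
    using LIMSEQ_Suc[OF lim] by (intro LIMSEQ_le_const[of "\<lambda>n. measure m (A (Suc n))" 0]) auto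
  then have "emeasure m N = 0" by (simp add: emeasure_eq_measure measure_le_0_iff)
  then have "AE x in m. x \<notin> N" using N by (intro AE_not_in null_setsI) auto
  then show ?thesis
  proof eventually_elim
    case (elim x)
    then obtain i where "x \<notin> A (Suc i)" by (auto simp: N_def)
    then show ?case
      using dec[of "Suc i"] by (auto simp: eventually_sequentially intro!: exI[of _ "Suc i"])
  qed
qed

section \<open>Late visits under rapid mixing\<close>

text \<open>Chebyshev's inequality for the sum \<open>Z\<close> of \<open>J\<close> samples of \<open>\<phi>\<close> at the times \<open>j * D\<close>. If the samples
  miss \<open>A\<close> then \<open>Z = 0\<close>, which is at distance \<open>J * p\<close> from the mean. Distinct samples are at least
  \<open>D\<close> apart and have covariance at most \<open>\<eta>\<close>; the diagonal contributes at most \<open>J * p\<close>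
  because \<open>\<phi>\<^sup>2 \<le> \<phi>\<close>.\<close>
lemma prob_no_hit_le:
  fixes \<phi> :: "'a \<Rightarrow> real" and \<eta> p :: real
  assumes prob: "prob_space m" and inv: "preserves_measure T m"
    and \<phi> [measurable]: "\<phi> \<in> borel_measurable m"
    and range: "\<And>x. x \<in> space m \<Longrightarrow> 0 \<le> \<phi> x \<and> \<phi> x \<le> 1"
    and supp: "\<And>x. x \<in> space m \<Longrightarrow> x \<notin> A \<Longrightarrow> \<phi> x = 0"
    and p: "p = (\<integral>x. \<phi> x \<partial>m)" "p > 0"
    and J: "J > 0"
    and corr: "\<And>d. d \<ge> D \<Longrightarrow> \<bar>(\<integral>x. \<phi> ((T ^^ d) x) * \<phi> x \<partial>m) - p\<^sup>2\<bar> \<le> \<eta>"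
  shows "measure m {x \<in> space m. \<forall>j<J. (T ^^ (j * D)) x \<notin> A} \<le> 1 / (real J * p) + \<eta> / p\<^sup>2"
proof -
  interpret prob_space m by (rule prob)
  have Tk [measurable]: "T ^^ k \<in> m \<rightarrow>\<^sub>M m" for k
    using preserves_measure_funpow[OF inv] by (simp add: preserves_measure_def)
  have Tsp: "(T ^^ k) x \<in> space m" if "x \<in> space m" for k x
    using measurable_space[OF Tk that] .
  define u where "u j x = \<phi> ((T ^^ (j * D)) x)" for j x
  have u [measurable]: "u j \<in> borel_measurable m" for j unfolding u_def by measurable
  have u01: "0 \<le> u j x \<and> u j x \<le> 1" if "x \<in> space m" for j x
    unfolding u_def using range Tsp that by blast
  have iu: "integrable m (u j)" for j
    by (rule integrable_const_bound[of _ 1]) (use u01 in auto)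
  have iuu: "integrable m (\<lambda>x. u i x * u j x)" for i j
    by (rule integrable_const_bound[of _ 1]) (use u01 in \<open>auto simp: abs_mult intro: mult_le_one\<close>)
  have Eu: "(\<integral>x. u j x \<partial>m) = p" for j
    unfolding u_def p by (rule integral_funpow[OF inv \<phi>])
  have "\<eta> \<ge> 0" using corr[of D] by linarith
  have pair_less: "(\<integral>x. u i x * u j x \<partial>m) \<le> p\<^sup>2 + \<eta>" if "i < j" for i j
  proof -
    define d where "d = (j - i) * D"
    have "(\<integral>x. u i x * u j x \<partial>m)
        = (\<integral>x. (\<lambda>y. \<phi> ((T ^^ d) y) * \<phi> y) ((T ^^ (i * D)) x) \<partial>m)"
    proof (rule arg_cong[where f = "integral\<^sup>L m"], rule ext)
      fix x
      have "j * D = d + i * D" unfolding d_def using that by (simp flip: add_mult_distrib)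
      then show "u i x * u j x = \<phi> ((T ^^ d) ((T ^^ (i * D)) x)) * \<phi> ((T ^^ (i * D)) x)"
        by (simp add: u_def funpow_add)
    qed
    also have "\<dots> = (\<integral>x. \<phi> ((T ^^ d) x) * \<phi> x \<partial>m)"
      by (rule integral_funpow[OF inv]) measurable
    also have "\<dots> \<le> p\<^sup>2 + \<eta>"
    proof -
      have "D \<le> d" unfolding d_def using that by (cases "j - i") auto
      from corr[OF this] show ?thesis by linarith
    qed
    finally show ?thesis .
  qed
  have pair: "(\<integral>x. u i x * u j x \<partial>m) \<le> (p\<^sup>2 + \<eta>) + (if i = j then p else 0)" for i j
  proof (rule linorder_cases[of i j])
    assume eq: "i = j"
    have "(\<integral>x. u i x * u j x \<partial>m) \<le> (\<integral>x. u i x \<partial>m)"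
      using eq u01 by (intro integral_mono iu iuu) (auto intro: mult_left_le)
    then show ?thesis using eq \<open>\<eta> \<ge> 0\<close> Eu by (smt (verit) zero_le_power2)
  qed (use pair_less[of i j] pair_less[of j i] in \<open>auto simp: mult.commute\<close>)
  define Z where "Z x = (\<Sum>j<J. u j x)" for x
  have Z2: "(Z x - real J * p)\<^sup>2
      = (\<Sum>i<J. \<Sum>j<J. u i x * u j x) - 2 * (real J * p) * (\<Sum>j<J. u j x) + (real J * p)\<^sup>2" for x
    by (simp add: power2_diff Z_def power2_eq_square sum_product algebra_simps)
  have iZ: "integrable m (\<lambda>x. (Z x - real J * p)\<^sup>2)"
    unfolding Z2 using iu iuu by auto
  have "(\<integral>x. (Z x - real J * p)\<^sup>2 \<partial>m)
      = (\<Sum>i<J. \<Sum>j<J. \<integral>x. u i x * u j x \<partial>m) - (real J * p)\<^sup>2"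
    unfolding Z2 using iu iuu by (simp add: Eu prob_space power2_eq_square)
  also have "\<dots> \<le> (\<Sum>i<J. \<Sum>j<J. (p\<^sup>2 + \<eta>) + (if i = j then p else 0)) - (real J * p)\<^sup>2"
    by (intro diff_right_mono sum_mono pair)
  also have "\<dots> = (real J)\<^sup>2 * \<eta> + real J * p"
    by (simp add: sum.distrib power2_eq_square algebra_simps)
  finally have var: "(\<integral>x. (Z x - real J * p)\<^sup>2 \<partial>m) \<le> (real J)\<^sup>2 * \<eta> + real J * p" .
  have "measure m {x \<in> space m. \<forall>j<J. (T ^^ (j * D)) x \<notin> A}
      \<le> measure m {x \<in> space m. (Z x - real J * p)\<^sup>2 \<ge> (real J * p)\<^sup>2}"
  proof (rule finite_measure_mono)
    show "{x \<in> space m. \<forall>j<J. (T ^^ (j * D)) x \<notin> A}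
        \<subseteq> {x \<in> space m. (Z x - real J * p)\<^sup>2 \<ge> (real J * p)\<^sup>2}"
      using supp Tsp by (auto simp: Z_def u_def)
    show "{x \<in> space m. (Z x - real J * p)\<^sup>2 \<ge> (real J * p)\<^sup>2} \<in> sets m"
      unfolding Z_def by measurable
  qed
  also have "\<dots> \<le> (\<integral>x. (Z x - real J * p)\<^sup>2 \<partial>m) / (real J * p)\<^sup>2"
    using p J by (intro integral_Markov_inequality_measure[OF iZ sets.top]) auto
  also have "\<dots> \<le> ((real J)\<^sup>2 * \<eta> + real J * p) / (real J * p)\<^sup>2"
    by (intro divide_right_mono var) auto
  also have "\<dots> = 1 / (real J * p) + \<eta> / p\<^sup>2"
    using p J by (simp add: power2_eq_square field_simps)
  finally show ?thesis .
qed

lemma lipschitz_norm_bounds: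
  fixes \<phi> :: "'a::metric_space \<Rightarrow> real"
  assumes "Z \<noteq> {}" and "L-lipschitz_on Z \<phi>" and "\<And>x. x \<in> Z \<Longrightarrow> \<bar>\<phi> x\<bar> \<le> 1"
  shows "0 \<le> lipschitz_norm Z \<phi>" "lipschitz_norm Z \<phi> \<le> 1 + L"
proof -
  obtain z where "z \<in> Z" using assms by blast
  have bdd: "bdd_above ((\<lambda>x. \<bar>\<phi> x\<bar>) ` Z)"
    using assms(3) by (intro bdd_aboveI[of _ 1]) auto
  have "0 \<le> (SUP x\<in>Z. \<bar>\<phi> x\<bar>)"
    using cSUP_upper[OF \<open>z \<in> Z\<close> bdd] by linarith
  moreover have "(SUP x\<in>Z. \<bar>\<phi> x\<bar>) \<le> 1"
    using assms by (intro cSUP_least) auto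
  moreover have "0 \<le> Inf {L. L-lipschitz_on Z \<phi>}"
    using assms(2) by (intro cInf_greatest) (auto dest: lipschitz_on_nonneg)
  moreover have "Inf {L. L-lipschitz_on Z \<phi>} \<le> L"
    using assms(2) by (intro cInf_lower bdd_belowI[of _ 0]) (auto dest: lipschitz_on_nonneg)
  ultimately show "0 \<le> lipschitz_norm Z \<phi>" "lipschitz_norm Z \<phi> \<le> 1 + L"
    by (auto simp: lipschitz_norm_def)
qed

lemma regular_decay_pos:
  assumes "regular_decay m A \<alpha>"
  shows "\<forall>\<^sub>F n in sequentially. measure m (A n) > 0"
proof -
  obtain c where c: "c > 0" "\<forall>\<^sub>F n in sequentially. measure m (A (Suc n)) > c * measure m (A n)"
    using assms by (auto simp: regular_decay_def)
  have "\<forall>\<^sub>F n in sequentially. measure m (A (Suc n)) > 0"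
    using c(2)
  proof eventually_elim
    case (elim n)
    have "0 \<le> c * measure m (A n)" using c(1) by simp
    with elim show ?case by linarith
  qed
  then show ?thesis
    using eventually_sequentially_Suc[of "\<lambda>n. measure m (A n) > 0"] by blast
qed

lemma regular_decay_bounds:
  assumes "regular_decay m A \<alpha>"
  shows "\<And>b. b < \<alpha> \<Longrightarrow> \<forall>\<^sub>F n in sequentially. measure m (A n) \<le> real n powr (-b)"
    and "\<And>b. b > \<alpha> \<Longrightarrow> \<forall>\<^sub>F n in sequentially. measure m (A n) \<ge> real n powr (-b)"
proof -
  have lim: "(\<lambda>n. ln (measure m (A n)) / (- ln (real n))) \<longlonglongrightarrow> \<alpha>"
    using assms by (auto simp: regular_decay_def)
  note pos = regular_decay_pos[OF assms]
  show "\<forall>\<^sub>F n in sequentially. measure m (A n) \<le> real n powr (-b)" if "b < \<alpha>" for b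
    using order_tendstoD(1)[OF lim that] pos eventually_gt_at_top[of 1]
  proof eventually_elim
    case (elim n)
    then have "ln (measure m (A n)) \<le> - b * ln (real n)"
      by (simp add: field_simps)
    then have "exp (ln (measure m (A n))) \<le> exp (- b * ln (real n))" by simp
    with elim show ?case by (simp add: powr_def)
  qed
  show "\<forall>\<^sub>F n in sequentially. measure m (A n) \<ge> real n powr (-b)" if "b > \<alpha>" for b
    using order_tendstoD(2)[OF lim that] pos eventually_gt_at_top[of 1]
  proof eventually_elim
    case (elim n)
    then have "- b * ln (real n) \<le> ln (measure m (A n))"
      by (simp add: field_simps)
    then have "exp (- b * ln (real n)) \<le> exp (ln (measure m (A n)))" by simp
    with elim show ?case by (simp add: powr_def)
  qed
qed

lemma lipschitz_on_ramp:
  fixes g :: "'a::metric_space \<Rightarrow> real"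
  assumes "L-lipschitz_on Z g" "w > 0"
  shows "(L / w)-lipschitz_on Z (\<lambda>x. max 0 (min 1 ((r - g x) / w)))"
proof (rule lipschitz_onI)
  show "0 \<le> L / w" using assms lipschitz_on_nonneg[OF assms(1)] by auto
  fix x y assume "x \<in> Z" "y \<in> Z"
  have "dist (max 0 (min 1 ((r - g x) / w))) (max 0 (min 1 ((r - g y) / w)))
      \<le> \<bar>(r - g x) / w - (r - g y) / w\<bar>"
    by (auto simp: dist_real_def max_def min_def)
  also have "\<dots> = dist (g x) (g y) / w"
    using assms by (simp add: dist_real_def diff_divide_distrib[symmetric] abs_minus_commute)
  also have "\<dots> \<le> L / w * dist x y"
    using lipschitz_onD[OF assms(1) \<open>x \<in> Z\<close> \<open>y \<in> Z\<close>] assms(2) by (simp add: divide_right_mono)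
  finally show "dist (max 0 (min 1 ((r - g x) / w))) (max 0 (min 1 ((r - g y) / w))) \<le> L / w * dist x y" .
qed

text \<open>A Lipschitz function below the indicator of \<open>A n\<close> whose integral is still comparable to the
  measure of \<open>A n\<close>. It equals \<open>1\<close> on the first \<open>A k\<close> of at most half the measure and falls to \<open>0\<close> at
  the boundary of \<open>A n\<close>. Regular decay prevents the measure of \<open>A k\<close> from being much less than
  half, and halving the measure separates the two levels of the defining function by a fixed
  fraction of the level of \<open>A n\<close>. So the Lipschitz constant is polynomial in the inverse of
  the measure. Passing from \<open>A n\<close> to \<open>A (Suc n)\<close> instead would not work, since these two
  may have the same measure.\<close>
lemma lipschitz_test_functions:
  fixes A :: "nat \<Rightarrow> 'a::metric_space set"
  assumes prob: "prob_space m"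
    and cont: "\<And>h::'a \<Rightarrow> real. continuous_on (space m) h \<Longrightarrow> h \<in> borel_measurable m"
    and meas: "\<And>n. n \<ge> 1 \<Longrightarrow> A n \<in> sets m"
    and reg: "regular_decay m A \<alpha>" and lip: "lipschitz_sublevels m (space m) A"
  shows "\<exists>c>0. \<exists>C\<ge>0. \<exists>\<beta>\<ge>0. \<forall>\<^sub>F n in sequentially. \<exists>\<phi>::'a \<Rightarrow> real.
    \<phi> \<in> borel_measurable m \<and> (C * measure m (A n) powr (-\<beta>))-lipschitz_on (space m) \<phi> \<and>
    (\<forall>x\<in>space m. 0 \<le> \<phi> x \<and> \<phi> x \<le> 1 \<and> (x \<notin> A n \<longrightarrow> \<phi> x = 0)) \<and>
    c * measure m (A n) \<le> (\<integral>x. \<phi> x \<partial>m)"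
proof -
  interpret prob_space m by (rule prob)
  define a where "a n = measure m (A n)" for n
  obtain \<beta> g L where \<beta>: "\<beta> \<ge> 0" and g: "L-lipschitz_on (space m) g"
    and A: "\<And>n. n \<ge> 1 \<Longrightarrow> A n = {x \<in> space m. g x \<le> a n powr \<beta>}"
    using lip unfolding lipschitz_sublevels_def a_def by blast
  obtain c n0 where c: "c > 0" and n0: "\<And>n. n \<ge> n0 \<Longrightarrow> a (Suc n) > c * a n"
    using reg by (auto simp: regular_decay_def eventually_sequentially a_def)
  obtain n1 where n1: "\<And>n. n \<ge> n1 \<Longrightarrow> a n > 0"
    using regular_decay_pos[OF reg] by (auto simp: eventually_sequentially a_def)
  have a0: "a \<longlonglongrightarrow> 0" using reg by (simp add: regular_decay_def a_def [abs_def])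
  have "\<exists>k>n. a k \<le> a n / 2 \<and> c / 2 * a n \<le> a k" if n: "n \<ge> max n0 n1" for n
  proof -
    have an: "a n > 0" using n1 n by auto
    have "\<forall>\<^sub>F k in sequentially. a k < a n / 2"
      using an by (intro order_tendstoD(2)[OF a0]) auto
    then obtain k1 where "\<And>k. k \<ge> k1 \<Longrightarrow> a k < a n / 2"
      by (auto simp: eventually_sequentially)
    then have ex: "a (n + max 1 k1) \<le> a n / 2" by (simp add: less_imp_le)
    define j where "j = (LEAST j. a (n + j) \<le> a n / 2)"
    have j: "a (n + j) \<le> a n / 2" unfolding j_def using ex by (rule LeastI)
    with an have "j \<noteq> 0" by (intro notI) auto
    then obtain i where i: "j = Suc i" by (cases j) auto
    have "a (n + i) > a n / 2"
      using not_less_Least[of i "\<lambda>j. a (n + j) \<le> a n / 2"] i j_def by auto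
    then have "c * (a n / 2) \<le> c * a (n + i)" using c by simp
    also have "\<dots> < a (n + j)" using n0[of "n + i"] n i by simp
    finally show ?thesis using j i by (intro exI[of _ "n + j"]) auto
  qed note half = this
  \<comment> \<open>With \<open>\<beta> = 0\<close> all levels would be \<open>1\<close> and the sets could not shrink.\<close>
  have "\<beta> \<noteq> 0"
  proof
    assume "\<beta> = 0"
    define n where "n = max 1 (max n0 n1)"
    obtain k where k: "k > n" "a k \<le> a n / 2" "c / 2 * a n \<le> a k"
      using half[of n] by (auto simp: n_def)
    have "a n > 0" "a k > 0" using n1 k by (auto simp: n_def)
    then have "A n = A k" using A[of n] A[of k] k \<open>\<beta> = 0\<close> by (auto simp: n_def)
    with k \<open>a n > 0\<close> show False by (auto simp: a_def)
  qed
  with \<beta> have \<beta>: "\<beta> > 0" by simp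
  define q where "q = 1 - (1 / 2 :: real) powr \<beta>"
  have q: "q > 0" unfolding q_def using \<beta> powr_less_mono2[of \<beta> "1/2" 1] by simp
  have L: "L \<ge> 0" using g by (rule lipschitz_on_nonneg)
  show ?thesis
  proof (intro exI conjI)
    show "c / 2 > 0" "L / q \<ge> 0" "\<beta> \<ge> 0" using c L q \<beta> by auto
    show "\<forall>\<^sub>F n in sequentially. \<exists>\<phi>::'a \<Rightarrow> real.
      \<phi> \<in> borel_measurable m \<and> (L / q * measure m (A n) powr (-\<beta>))-lipschitz_on (space m) \<phi> \<and>
      (\<forall>x\<in>space m. 0 \<le> \<phi> x \<and> \<phi> x \<le> 1 \<and> (x \<notin> A n \<longrightarrow> \<phi> x = 0)) \<and>
      c / 2 * measure m (A n) \<le> (\<integral>x. \<phi> x \<partial>m)"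
      using eventually_ge_at_top[of "max 1 (max n0 n1)"]
    proof eventually_elim
      case (elim n)
      then obtain k where k: "k > n" "a k \<le> a n / 2" "c / 2 * a n \<le> a k"
        using half[of n] by auto
      have an: "a n > 0" and ak: "a k > 0" using n1 k elim by auto
      define w where "w = q * a n powr \<beta>"
      have w: "w > 0" using q an by (simp add: w_def)
      have "a k powr \<beta> \<le> (a n * (1 / 2)) powr \<beta>"
        using k ak \<beta> by (intro powr_mono2) auto
      also have "\<dots> = a n powr \<beta> * (1 / 2) powr \<beta>"
        using an by (simp only: powr_mult)
      also have "\<dots> = a n powr \<beta> - w"
        by (simp add: w_def q_def algebra_simps)
      finally have gap: "a k powr \<beta> \<le> a n powr \<beta> - w" .
      define \<phi> where "\<phi> x = max 0 (min 1 ((a n powr \<beta> - g x) / w))" for x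
      have lip\<phi>: "(L / w)-lipschitz_on (space m) \<phi>"
        unfolding \<phi>_def by (rule lipschitz_on_ramp[OF g w])
      have meas\<phi>: "\<phi> \<in> borel_measurable m"
        by (rule cont[OF lipschitz_on_continuous_on[OF lip\<phi>]])
      have out: "\<phi> x = 0" if "x \<in> space m" "x \<notin> A n" for x
        using that A[of n] elim w by (auto simp: \<phi>_def max_def min_def field_simps)
      have ins: "\<phi> x = 1" if "x \<in> A k" for x
      proof -
        have "g x \<le> a n powr \<beta> - w" using that A[of k] k gap by auto
        then have "1 \<le> (a n powr \<beta> - g x) / w" using w by (simp add: field_simps)
        then show ?thesis by (simp add: \<phi>_def)
      qed
      have "c / 2 * a n \<le> a k" by (rule k)
      also have "a k = (\<integral>x. indicator (A k) x \<partial>m)"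
        using meas[of k] k by (simp add: a_def Int_absorb2 sets.sets_into_space)
      also have "\<dots> \<le> (\<integral>x. \<phi> x \<partial>m)"
      proof (rule integral_mono)
        show "integrable m (indicator (A k) :: 'a \<Rightarrow> real)"
          using meas[of k] k by (intro integrable_real_indicator) (auto simp: less_top[symmetric])
        show "integrable m \<phi>"
          by (rule integrable_const_bound[of _ 1]) (auto simp: meas\<phi>, auto simp: \<phi>_def)
        show "indicator (A k) x \<le> \<phi> x" for x
          using ins[of x] by (auto simp: indicator_def \<phi>_def)
      qed
      finally have "c / 2 * a n \<le> (\<integral>x. \<phi> x \<partial>m)" .
      moreover have "L / w = L / q * a n powr (- \<beta>)"
        by (simp add: w_def powr_minus field_simps)
      ultimately show ?case
        using meas\<phi> lip\<phi> out unfolding a_def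
        by (intro exI[of _ \<phi>]) (auto simp: \<phi>_def)
    qed
  qed
qed

text \<open>Normalising the measure by \<open>v\<close> multiplies the levels by \<open>v\<close> to the power \<open>-\<beta>\<close>, which is absorbed
  by the Lipschitz function.\<close>
lemma lipschitz_sublevels_rescale:
  assumes lip: "lipschitz_sublevels M Z A" and v: "v > 0"
    and eq: "\<And>n. n \<ge> 1 \<Longrightarrow> measure m (A n) = measure M (A n) / v"
  shows "lipschitz_sublevels m Z A"
proof -
  obtain \<beta> g L where \<beta>: "\<beta> \<ge> 0" and g: "L-lipschitz_on Z g" "\<forall>x\<in>Z. g x \<ge> 0"
    and A: "\<forall>n\<ge>1. A n = {x \<in> Z. g x \<le> measure M (A n) powr \<beta>}"
    using lip unfolding lipschitz_sublevels_def by blast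
  define h where "h x = g x / v powr \<beta>" for x
  have vb: "v powr \<beta> > 0" using v by simp
  have "(L / v powr \<beta>)-lipschitz_on Z h"
  proof (rule lipschitz_onI)
    show "0 \<le> L / v powr \<beta>" using lipschitz_on_nonneg[OF g(1)] by simp
    fix x y assume xy: "x \<in> Z" "y \<in> Z"
    have "dist (h x) (h y) = dist (g x) (g y) / v powr \<beta>"
      using vb by (simp add: h_def dist_real_def diff_divide_distrib[symmetric])
    also have "\<dots> \<le> L / v powr \<beta> * dist x y"
      using lipschitz_onD[OF g(1) xy] vb by (simp add: divide_right_mono)
    finally show "dist (h x) (h y) \<le> L / v powr \<beta> * dist x y" .
  qed
  moreover have "\<forall>x\<in>Z. h x \<ge> 0" using g(2) by (auto simp: h_def)
  moreover have "\<forall>n\<ge>1. A n = {x \<in> Z. h x \<le> measure m (A n) powr \<beta>}"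
  proof (intro allI impI)
    fix n :: nat assume n: "n \<ge> 1"
    have "measure m (A n) powr \<beta> = measure M (A n) powr \<beta> / v powr \<beta>"
      using eq[OF n] v by (simp add: powr_divide)
    then have "h x \<le> measure m (A n) powr \<beta> \<longleftrightarrow> g x \<le> measure M (A n) powr \<beta>" for x
      using vb by (simp add: h_def divide_le_cancel)
    then show "A n = {x \<in> Z. h x \<le> measure m (A n) powr \<beta>}" using A n by simp
  qed
  ultimately show ?thesis
    unfolding lipschitz_sublevels_def using \<beta> by blast
qed

lemma lipschitz_sublevels_sets:
  fixes A :: "nat \<Rightarrow> 'a::metric_space set"
  assumes lip: "lipschitz_sublevels M Z A" and n: "n \<ge> 1"
    and cont: "\<And>h::'a \<Rightarrow> real. continuous_on (space m) h \<Longrightarrow> h \<in> borel_measurable m"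
    and sp: "space m = Z"
  shows "A n \<in> sets m"
proof -
  obtain \<beta> g L where g: "L-lipschitz_on Z g"
    and A: "\<forall>n\<ge>1. A n = {x \<in> Z. g x \<le> measure M (A n) powr \<beta>}"
    using lip unfolding lipschitz_sublevels_def by blast
  have [measurable]: "g \<in> borel_measurable m"
    using lipschitz_on_continuous_on[OF g] sp by (intro cont) simp
  have "{x \<in> space m. g x \<le> measure M (A n) powr \<beta>} \<in> sets m" by measurable
  also have "{x \<in> space m. g x \<le> measure M (A n) powr \<beta>} = A n" using A n sp by simp
  finally show ?thesis .
qed

text \<open>The quantitative bound \<open>prob_no_hit_le\<close> with \<open>D\<close> and \<open>J\<close> powers of \<open>n\<close>. Rapid mixing is used only
  through one polynomial rate, chosen after the exponents of the Lipschitz constant and of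
  the measure are known.\<close>
lemma AE_eventually_hit:
  fixes A :: "nat \<Rightarrow> 'a::metric_space set"
  assumes prob: "prob_space m" and inv: "preserves_measure T m"
    and cont: "\<And>h::'a \<Rightarrow> real. continuous_on (space m) h \<Longrightarrow> h \<in> borel_measurable m"
    and meas: "\<And>n. n \<ge> 1 \<Longrightarrow> A n \<in> sets m"
    and dec: "\<And>n k. 1 \<le> n \<Longrightarrow> n \<le> k \<Longrightarrow> A k \<subseteq> A n"
    and reg: "regular_decay m A \<alpha>" and lip: "lipschitz_sublevels m (space m) A"
    and mixing: "SPDC T m" and b: "b > \<alpha>"
  shows "AE x in m. \<forall>\<^sub>F n in sequentially. \<exists>k. real k \<le> real n powr b \<and> (T ^^ k) x \<in> A n"
proof -
  interpret prob_space m by (rule prob)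
  have Tk [measurable]: "T ^^ k \<in> m \<rightarrow>\<^sub>M m" for k
    using preserves_measure_funpow[OF inv] by (simp add: preserves_measure_def)
  have \<alpha>0: "\<alpha> \<ge> 0" using reg by (simp add: regular_decay_def)
  define \<delta> where "\<delta> = (b - \<alpha>) / 6"
  have \<delta>: "\<delta> > 0" and b_eq: "b = \<alpha> + 6 * \<delta>" using b by (auto simp: \<delta>_def field_simps)
  define a' where "a' = \<alpha> + \<delta>"
  have a': "a' > 0" using \<alpha>0 \<delta> by (simp add: a'_def)
  obtain c C \<beta> where c: "c > 0" and C: "C \<ge> 0" and \<beta>: "\<beta> \<ge> 0"
    and test: "\<forall>\<^sub>F n in sequentially. \<exists>\<phi>::'a \<Rightarrow> real.
      \<phi> \<in> borel_measurable m \<and> (C * measure m (A n) powr (-\<beta>))-lipschitz_on (space m) \<phi> \<and>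
      (\<forall>x\<in>space m. 0 \<le> \<phi> x \<and> \<phi> x \<le> 1 \<and> (x \<notin> A n \<longrightarrow> \<phi> x = 0)) \<and>
      c * measure m (A n) \<le> (\<integral>x. \<phi> x \<partial>m)"
    using lipschitz_test_functions[OF prob cont meas reg lip] by blast
  obtain \<Theta> where \<Theta>: "\<And>a. a > 0 \<Longrightarrow> (\<lambda>n. real n powr a * \<Theta> n) \<longlonglongrightarrow> 0"
    and corr: "\<And>\<phi> \<psi> n. bounded_lipschitz (space m) \<phi> \<Longrightarrow> bounded_lipschitz (space m) \<psi> \<Longrightarrow>
      \<bar>(\<integral>x. \<phi> ((T ^^ n) x) * \<psi> x \<partial>m) - (\<integral>x. \<phi> x \<partial>m) * (\<integral>x. \<psi> x \<partial>m)\<bar>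
      \<le> lipschitz_norm (space m) \<phi> * lipschitz_norm (space m) \<psi> * \<Theta> n"
    using mixing unfolding SPDC_def by blast
  \<comment> \<open>The measure of \<open>A n\<close> is at least \<open>n\<close> to the power \<open>-a'\<close>, so the squared Lipschitz norm costs
      \<open>2 * \<beta> * a'\<close>, the division by \<open>p\<^sup>2\<close> costs \<open>2 * a'\<close>, and \<open>\<delta>\<close> is the decay that remains. As the
      gap \<open>D\<close> is \<open>n\<close> to the power \<open>\<delta>\<close>, the correlations must decay with the rate \<open>s\<close>.\<close>
  define s where "s = (2 * \<beta> * a' + 2 * a' + \<delta>) / \<delta>"
  have s: "s > 0" using \<beta> a' \<delta> by (auto simp: s_def intro!: divide_pos_pos add_nonneg_pos)
  have s\<delta>: "\<delta> * s = 2 * \<beta> * a' + 2 * a' + \<delta>" using \<delta> by (simp add: s_def)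
  have "\<forall>\<^sub>F d in sequentially. \<bar>\<Theta> d\<bar> \<le> real d powr (-s)"
    using order_tendstoD(2)[OF tendsto_rabs_zero[OF \<Theta>[OF s]] zero_less_one] eventually_gt_at_top[of 0]
    by eventually_elim (simp add: abs_mult powr_minus field_simps)
  then obtain d0 where d0: "\<And>d. d \<ge> d0 \<Longrightarrow> \<bar>\<Theta> d\<bar> \<le> real d powr (-s)"
    by (auto simp: eventually_sequentially)
  define D where "D n = nat \<lceil>real n powr \<delta>\<rceil>" for n
  define J where "J n = nat \<lceil>real n powr (a' + 2 * \<delta>)\<rceil>" for n
  define E where "E n = {x \<in> space m. \<forall>j<J n. (T ^^ (j * D n)) x \<notin> A (max 1 n)}" for n
  have E: "E n \<in> sets m" for n
  proof -
    have "Measurable.pred m (\<lambda>x. x \<in> A (max 1 n))"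
      using meas[of "max 1 n"] by simp
    then have "Measurable.pred m (\<lambda>x. (T ^^ k) x \<in> A (max 1 n))" for k
      by (rule measurable_compose[OF Tk])
    note [measurable] = this
    show ?thesis unfolding E_def by measurable
  qed
  have large: "\<forall>\<^sub>F n in sequentially. real d0 \<le> real n powr \<delta>"
    using \<delta> by real_asymp
  have size: "\<forall>\<^sub>F n in sequentially. measure m (A n) \<ge> real n powr (-a')"
    using \<delta> by (intro regular_decay_bounds(2)[OF reg]) (simp add: a'_def)
  have "\<forall>\<^sub>F n in sequentially.
      measure m (E n) \<le> (1 / c + (1 + C)\<^sup>2 / c\<^sup>2) * real n powr (-\<delta>)"
    using test size large eventually_ge_at_top[of 1]
  proof eventually_elim
    case (elim n)
    note an = elim(2)
    obtain \<phi> :: "'a \<Rightarrow> real" where \<phi>: "\<phi> \<in> borel_measurable m"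
      "(C * measure m (A n) powr (-\<beta>))-lipschitz_on (space m) \<phi>"
      "\<And>x. x \<in> space m \<Longrightarrow> 0 \<le> \<phi> x \<and> \<phi> x \<le> 1"
      "\<And>x. x \<in> space m \<Longrightarrow> x \<notin> A n \<Longrightarrow> \<phi> x = 0"
      "c * measure m (A n) \<le> (\<integral>x. \<phi> x \<partial>m)"
      using elim by blast
    define p where "p = (\<integral>x. \<phi> x \<partial>m)"
    have n0: "real n \<ge> 1" using elim by simp
    have n0': "n > 0" using elim by simp
    have p_ge: "p \<ge> c * real n powr (-a')"
    proof -
      have "c * real n powr (-a') \<le> c * measure m (A n)" using c an by simp
      with \<phi>(5) show ?thesis by (simp add: p_def)
    qed
    have cn: "c * real n powr (-a') > 0" using c n0 by simp
    with p_ge have p: "p > 0" by linarith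
    have J_ge: "real (J n) \<ge> real n powr (a' + 2 * \<delta>)" unfolding J_def by linarith
    have "real n powr (a' + 2 * \<delta>) > 0" using n0 by simp
    with J_ge have Jn: "J n > 0" by (intro Nat.gr0I) auto
    have norm: "0 \<le> lipschitz_norm (space m) \<phi>"
      "lipschitz_norm (space m) \<phi> \<le> (1 + C) * real n powr (\<beta> * a')"
    proof -
      have *: "\<And>x. x \<in> space m \<Longrightarrow> \<bar>\<phi> x\<bar> \<le> 1" using \<phi>(3) by auto
      note lipschitz_norm_bounds[OF not_empty \<phi>(2) *]
      moreover have "measure m (A n) powr (-\<beta>) \<le> real n powr (\<beta> * a')"
      proof -
        have "measure m (A n) powr (-\<beta>) \<le> (real n powr (-a')) powr (-\<beta>)"
          using an \<beta> n0' by (intro powr_mono2') auto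
        also have "\<dots> = real n powr (\<beta> * a')" by (simp add: powr_powr mult.commute)
        finally show ?thesis .
      qed
      then have "C * measure m (A n) powr (-\<beta>) \<le> C * real n powr (\<beta> * a')"
        using C by (rule mult_left_mono)
      moreover have "1 \<le> real n powr (\<beta> * a')"
        using n0 \<beta> a' by (intro ge_one_powr_ge_zero) auto
      ultimately show "0 \<le> lipschitz_norm (space m) \<phi>"
        "lipschitz_norm (space m) \<phi> \<le> (1 + C) * real n powr (\<beta> * a')"
        by (auto simp: algebra_simps)
    qed
    have "bounded (\<phi> ` space m)"
      unfolding bounded_iff using \<phi>(3) by (auto intro!: exI[of _ 1])
    with \<phi>(2) have bl: "bounded_lipschitz (space m) \<phi>"
      unfolding bounded_lipschitz_def by blast
    define \<eta> where "\<eta> = (1 + C)\<^sup>2 * real n powr (- 2 * a' - \<delta>)"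
    have corr': "\<bar>(\<integral>x. \<phi> ((T ^^ d) x) * \<phi> x \<partial>m) - p\<^sup>2\<bar> \<le> \<eta>" if d: "d \<ge> D n" for d
    proof -
      have dn: "real n powr \<delta> \<le> real d" using d unfolding D_def by linarith
      have "real n powr \<delta> > 0" using n0 by simp
      then have "\<bar>\<Theta> d\<bar> \<le> (real n powr \<delta>) powr (-s)"
        using d0[of d] dn elim s
        by (intro order_trans[OF d0[of d]] powr_mono2') auto
      also have "\<dots> = real n powr (- (2 * \<beta> * a') - 2 * a' - \<delta>)"
        unfolding powr_powr using s\<delta> by (intro arg_cong2[where f = "(powr)"]) auto
      finally have th: "\<bar>\<Theta> d\<bar> \<le> real n powr (- (2 * \<beta> * a') - 2 * a' - \<delta>)" .
      have "\<bar>(\<integral>x. \<phi> ((T ^^ d) x) * \<phi> x \<partial>m) - p\<^sup>2\<bar>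
          \<le> lipschitz_norm (space m) \<phi> * lipschitz_norm (space m) \<phi> * \<Theta> d"
        using corr[OF bl bl, of d] by (simp add: p_def power2_eq_square)
      also have "\<dots> \<le> lipschitz_norm (space m) \<phi> * lipschitz_norm (space m) \<phi> * \<bar>\<Theta> d\<bar>"
        using norm by (intro mult_left_mono) auto
      also have "\<dots> \<le> ((1 + C) * real n powr (\<beta> * a')) * ((1 + C) * real n powr (\<beta> * a'))
          * real n powr (- (2 * \<beta> * a') - 2 * a' - \<delta>)"
        using norm th C by (intro mult_mono) auto
      also have "\<dots> = (1 + C)\<^sup>2 * (real n powr (\<beta> * a') * real n powr (\<beta> * a')
          * real n powr (- (2 * \<beta> * a') - 2 * a' - \<delta>))"
        by (simp add: power2_eq_square)
      also have "\<dots> = \<eta>"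
        by (simp add: \<eta>_def powr_add[symmetric])
      finally show ?thesis .
    qed
    have "measure m (E n) \<le> 1 / (real (J n) * p) + \<eta> / p\<^sup>2"
      using prob_no_hit_le[OF prob inv \<phi>(1) \<phi>(3,4) p_def p Jn corr'] elim
      by (simp add: E_def max_def)
    also have "\<dots> \<le> 1 / (real n powr (a' + 2 * \<delta>) * (c * real n powr (-a')))
        + \<eta> / (c * real n powr (-a'))\<^sup>2"
      using J_ge p_ge cn n0' p Jn c unfolding \<eta>_def
      by (intro add_mono divide_left_mono mult_mono power_mono mult_pos_pos) auto
    also have "\<dots> = 1 / c * real n powr (- 2 * \<delta>) + (1 + C)\<^sup>2 / c\<^sup>2 * real n powr (-\<delta>)"
      using n0' c
      by (simp add: \<eta>_def power2_eq_square powr_add powr_diff powr_minus field_simps)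
         (simp add: powr_add[symmetric] ac_simps)
    also have "\<dots> \<le> (1 / c + (1 + C)\<^sup>2 / c\<^sup>2) * real n powr (-\<delta>)"
    proof -
      have "real n powr (- 2 * \<delta>) \<le> real n powr (-\<delta>)"
        using n0 \<delta> by (intro powr_mono) auto
      then have "1 / c * real n powr (- 2 * \<delta>) \<le> 1 / c * real n powr (-\<delta>)"
        using c by (intro mult_left_mono) auto
      then show ?thesis by (simp add: distrib_right)
    qed
    finally show ?case .
  qed
  then have avoid: "AE x in m. \<forall>\<^sub>F i in sequentially. x \<notin> E (2 ^ i)"
    using \<delta> E by (intro AE_eventually_avoids_dyadic[of m E \<delta>]) (auto intro: finite_measure)
  have slack: "\<forall>\<^sub>F n in sequentially. 4 * (2 * real n) powr (a' + 3 * \<delta>) \<le> real n powr b"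
    unfolding b_eq a'_def using \<alpha>0 \<delta> by real_asymp
  show ?thesis
    using avoid AE_space
  proof eventually_elim
    case (elim x)
    show ?case
      using eventually_dyadic_bracket[OF elim(1)] slack
    proof eventually_elim
      case (elim n)
      \<comment> \<open>A visit to the smaller target \<open>A (2 * k)\<close> is a visit to \<open>A n\<close>.\<close>
      then obtain k where k: "k > 0" "x \<notin> E (2 * k)" "k \<le> n" "n < 2 * k" by blast
      then obtain j where j: "j < J (2 * k)" "(T ^^ (j * D (2 * k))) x \<in> A (2 * k)"
        using \<open>x \<in> space m\<close> by (auto simp: E_def)
      have ceil: "real (nat \<lceil>real (2 * k) powr e\<rceil>) \<le> 2 * real (2 * k) powr e" if "e > 0" for e
      proof -
        have "1 \<le> real (2 * k) powr e" using k that by (intro ge_one_powr_ge_zero) auto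
        then show ?thesis by linarith
      qed
      have "real (j * D (2 * k)) \<le> real (J (2 * k)) * real (D (2 * k))"
        using j by (simp add: mult_right_mono)
      also have "\<dots> \<le> (2 * real (2 * k) powr (a' + 2 * \<delta>)) * (2 * real (2 * k) powr \<delta>)"
        unfolding J_def D_def using \<delta> a' by (intro mult_mono ceil mult_nonneg_nonneg powr_ge_zero of_nat_0_le_iff) auto
      also have "\<dots> = 4 * real (2 * k) powr (a' + 3 * \<delta>)"
        by (simp add: powr_add[symmetric] ac_simps)
      also have "\<dots> \<le> 4 * (2 * real n) powr (a' + 3 * \<delta>)"
        using k \<delta> a' by (intro mult_left_mono powr_mono2) auto
      also have "\<dots> \<le> real n powr b" by (rule elim)
      finally have "real (j * D (2 * k)) \<le> real n powr b" .
      moreover have "(T ^^ (j * D (2 * k))) x \<in> A n"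
      proof (cases "n = 0")
        case False then show ?thesis using j(2) dec[of n "2 * k"] k by auto
      qed (use k in auto)
      ultimately show ?case by blast
    qed
  qed
qed

section \<open>The induced system\<close>

locale recurrent_domain =
  fixes f :: "'a \<Rightarrow> 'a" and M :: "'a measure" and Y :: "'a set"
  assumes preserving: "preserves_measure f M"
    and conservative: "conservative f M"
    and domain: "Y \<in> sets M" "0 < emeasure M Y" "emeasure M Y < \<infinity>"
begin

abbreviation R where "R \<equiv> return_time f Y"
abbreviation T where "T \<equiv> induced_map f Y"
abbreviation m where "m \<equiv> induced_measure M Y"

lemma measurable_iterate [measurable]: "f ^^ k \<in> M \<rightarrow>\<^sub>M M"
  using preserves_measure_funpow[OF preserving] by (simp add: preserves_measure_def)

lemma pred_iterate [measurable]:
  "A \<in> sets M \<Longrightarrow> Measurable.pred M (\<lambda>x. (f ^^ k) x \<in> A)"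
  by (rule measurable_compose[OF measurable_iterate]) simp

lemma Y_subset: "Y \<subseteq> space M"
  using domain(1) by (rule sets.sets_into_space)

lemma AE_iterates:
  assumes "AE x in M. P x"
  shows "AE x in M. \<forall>k. P ((f ^^ k) x)"
proof -
  have "AE x in M. P ((f ^^ k) x)" for k
  proof (rule AE_distrD[OF measurable_iterate])
    show "AE x in distr M M (f ^^ k). P x"
    proof -
      have "distr M M (f ^^ k) = M"
        using preserves_measure_funpow[OF preserving] by (simp add: preserves_measure_def)
      then show ?thesis using assms by metis
    qed
  qed
  then show ?thesis by (simp add: AE_all_countable)
qed

lemma return_time_pos_iff: "R x > 0 \<longleftrightarrow> (\<exists>n>0. (f ^^ n) x \<in> Y)"
proof
  assume "\<exists>n>0. (f ^^ n) x \<in> Y"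
  then show "R x > 0" using LeastI_ex[of "\<lambda>n. n > 0 \<and> (f ^^ n) x \<in> Y"] by (simp add: return_time_def)
qed (auto simp: return_time_def split: if_splits)

lemma return_time_eq_iff:
  assumes "k > 0"
  shows "R x = k \<longleftrightarrow> (f ^^ k) x \<in> Y \<and> (\<forall>j. 0 < j \<and> j < k \<longrightarrow> (f ^^ j) x \<notin> Y)"
proof
  assume k: "R x = k"
  with assms have ex: "\<exists>n>0. (f ^^ n) x \<in> Y" using return_time_pos_iff[of x] by simp
  with k have "k = (LEAST n. n > 0 \<and> (f ^^ n) x \<in> Y)" by (simp add: return_time_def)
  then show "(f ^^ k) x \<in> Y \<and> (\<forall>j. 0 < j \<and> j < k \<longrightarrow> (f ^^ j) x \<notin> Y)"
    using LeastI_ex[OF ex] not_less_Least[of _ "\<lambda>n. n > 0 \<and> (f ^^ n) x \<in> Y"] by blast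
next
  assume k: "(f ^^ k) x \<in> Y \<and> (\<forall>j. 0 < j \<and> j < k \<longrightarrow> (f ^^ j) x \<notin> Y)"
  have "(LEAST n. n > 0 \<and> (f ^^ n) x \<in> Y) = k"
    using k assms by (intro Least_equality) (auto simp flip: not_less)
  then show "R x = k" using k assms by (auto simp: return_time_def)
qed

lemma return_time_le:
  assumes "k > 0" "(f ^^ k) x \<in> Y"
  shows "0 < R x" "R x \<le> k"
proof -
  show "0 < R x" using assms return_time_pos_iff by blast
  then show "R x \<le> k"
    using return_time_eq_iff[of "R x" x] assms by (meson not_less)
qed

lemma induced_map_in: "x \<in> Y \<Longrightarrow> T x \<in> Y"
  using return_time_eq_iff[of "R x" x] by (cases "R x = 0") (auto simp: induced_map_def)

lemma induced_iterate_in: "x \<in> Y \<Longrightarrow> (T ^^ k) x \<in> Y"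
  by (induction k) (auto simp: induced_map_in)

text \<open>The points where the induced map is the identity by convention. They form a wandering set,
  hence a null set.\<close>
definition never_return :: "'a set" where
  "never_return = {x \<in> Y. R x = 0}"

lemma never_return_eq: "never_return = {x \<in> space M. x \<in> Y \<and> (\<forall>k>0. (f ^^ k) x \<notin> Y)}"
proof -
  have "R x = 0 \<longleftrightarrow> (\<forall>k>0. (f ^^ k) x \<notin> Y)" for x
    using return_time_pos_iff[of x] by auto
  then show ?thesis using Y_subset by (auto simp: never_return_def)
qed

lemma never_return_sets [measurable]: "never_return \<in> sets M"
  using domain(1) unfolding never_return_eq by measurable

lemma emeasure_never_return: "emeasure M never_return = 0"
proof -
  have "disjoint_family (\<lambda>n::nat. (f ^^ n) -` never_return \<inter> space M)"
  proof -
    have False if "i < j" "(f ^^ i) x \<in> never_return" "(f ^^ j) x \<in> never_return" for i j x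
    proof -
      have "(f ^^ (j - i)) ((f ^^ i) x) = (f ^^ j) x"
        using that(1) by (simp flip: funpow_add o_apply[of "f ^^ _" "f ^^ _"])
      moreover have "(f ^^ (j - i)) ((f ^^ i) x) \<notin> Y"
        using that(1,2) unfolding never_return_eq by simp
      ultimately show False using that(3) unfolding never_return_eq by simp
    qed
    then have "i = j" if "(f ^^ i) x \<in> never_return" "(f ^^ j) x \<in> never_return" for i j x
      using that by (metis linorder_neqE_nat)
    then show ?thesis
      unfolding disjoint_family_on_def by blast
  qed
  then show ?thesis
    using conservative never_return_sets by (auto simp: conservative_def)
qed

lemma AE_not_never_return: "AE x in M. x \<notin> never_return"
  by (rule AE_not_in) (auto intro: null_setsI emeasure_never_return)

text \<open>An entrance counts time \<open>0\<close>, whereas a return takes at least one step. Comparing the two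
  is what yields both the invariance of the induced measure and Kac's formula.\<close>
definition first_entrance :: "nat \<Rightarrow> 'a set \<Rightarrow> 'a set" where
  "first_entrance n A = {x \<in> space M. (\<forall>j<n. (f ^^ j) x \<notin> Y) \<and> (f ^^ n) x \<in> A}"

definition first_return :: "nat \<Rightarrow> 'a set \<Rightarrow> 'a set" where
  "first_return k A = {x \<in> Y. R x = k \<and> (f ^^ k) x \<in> A}"

lemma first_entrance_sets [measurable]: "A \<in> sets M \<Longrightarrow> first_entrance n A \<in> sets M"
  using domain(1) unfolding first_entrance_def by measurable

lemma first_return_Suc:
  assumes "A \<subseteq> Y"
  shows "first_return (Suc k) A
    = {x \<in> space M. x \<in> Y \<and> (\<forall>j<k. (f ^^ Suc j) x \<notin> Y) \<and> (f ^^ Suc k) x \<in> A}"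
proof -
  have "(\<forall>j. 0 < j \<and> j < Suc k \<longrightarrow> (f ^^ j) x \<notin> Y) \<longleftrightarrow> (\<forall>j<k. (f ^^ Suc j) x \<notin> Y)" for x
    by (metis Suc_less_eq Suc_pred zero_less_Suc)
  then show ?thesis
    using assms Y_subset return_time_eq_iff[of "Suc k"] by (auto simp: first_return_def)
qed

lemma first_return_sets [measurable]:
  assumes "A \<in> sets M" "A \<subseteq> Y"
  shows "first_return (Suc k) A \<in> sets M"
  using domain(1) assms(1) unfolding first_return_Suc[OF assms(2)] by measurable

text \<open>The preimage under \<open>f\<close> of the points entering after \<open>n\<close> steps consists of the points entering
  after \<open>n + 1\<close> steps, and of the points of \<open>Y\<close> that return after \<open>n + 1\<close> steps. Iterating this
  identity takes the place of the Kakutani tower, whose floors would be forward images of \<open>Y\<close>.\<close>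
lemma emeasure_first_entrance_Suc:
  assumes A: "A \<in> sets M" "A \<subseteq> Y"
  shows "emeasure M (first_entrance n A)
    = emeasure M (first_return (Suc n) A) + emeasure M (first_entrance (Suc n) A)"
proof -
  have "emeasure M (first_entrance n A) = emeasure (distr M M f) (first_entrance n A)"
    using preserving by (simp add: preserves_measure_def)
  also have "\<dots> = emeasure M (f -` first_entrance n A \<inter> space M)"
    using preserving first_entrance_sets[OF A(1)]
    by (intro emeasure_distr) (auto simp: preserves_measure_def)
  also have "f -` first_entrance n A \<inter> space M
      = first_return (Suc n) A \<union> first_entrance (Suc n) A"
  proof -
    have "f x \<in> space M" if "x \<in> space M" for x
      using preserving that by (auto simp: preserves_measure_def dest: measurable_space)
    moreover have "(\<forall>j<Suc n. (f ^^ j) x \<notin> Y) \<longleftrightarrow> x \<notin> Y \<and> (\<forall>j<n. (f ^^ Suc j) x \<notin> Y)" for x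
      by (auto simp: less_Suc_eq_0_disj)
    ultimately show ?thesis
      unfolding first_return_Suc[OF A(2)] first_entrance_def
      by (auto simp: funpow_swap1)
  qed
  also have "emeasure M \<dots>
      = emeasure M (first_return (Suc n) A) + emeasure M (first_entrance (Suc n) A)"
    by (intro plus_emeasure[symmetric] first_return_sets first_entrance_sets A)
       (auto simp: first_return_def first_entrance_def)
  finally show ?thesis .
qed

lemma emeasure_eq_sum_first_return:
  assumes A: "A \<in> sets M" "A \<subseteq> Y"
  shows "emeasure M A
    = (\<Sum>k<n. emeasure M (first_return (Suc k) A)) + emeasure M (first_entrance n A)"
proof (induction n)
  case 0
  have "first_entrance 0 A = A"
    using A Y_subset by (auto simp: first_entrance_def)
  then show ?case by simp
next
  case (Suc n)
  then show ?case
    by (simp add: emeasure_first_entrance_Suc[OF A, of n] add.assoc)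
qed

lemma induced_vimage_eq:
  assumes "A \<subseteq> Y"
  shows "T -` A \<inter> Y = (\<Union>k. first_return (Suc k) A) \<union> (never_return \<inter> A)"
  (is "?L = ?R")
proof
  show "?L \<subseteq> ?R"
  proof
    fix x assume x: "x \<in> ?L"
    show "x \<in> ?R"
    proof (cases "R x")
      case 0 with x show ?thesis by (auto simp: never_return_def induced_map_def)
    next
      case (Suc k) 
      with x have "x \<in> first_return (Suc k) A" by (auto simp: first_return_def induced_map_def)
      then show ?thesis by blast
    qed
  qed
  show "?R \<subseteq> ?L"
  proof
    fix x assume "x \<in> ?R"
    then consider k where "x \<in> first_return (Suc k) A" | "x \<in> never_return" "x \<in> A" by blast
    then show "x \<in> ?L"
      by cases (auto simp: first_return_def never_return_def induced_map_def)
  qed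
qed

text \<open>Only an inequality, since the first entrance term is dropped. On a finite measure it
  improves to an equality by applying it to the complement as well.\<close>
lemma emeasure_induced_vimage_le:
  assumes A: "A \<in> sets M" "A \<subseteq> Y"
  shows "emeasure M (T -` A \<inter> Y) \<le> emeasure M A"
proof -
  have "emeasure M (T -` A \<inter> Y) \<le> emeasure M (\<Union>k. first_return (Suc k) A)
      + emeasure M (never_return \<inter> A)"
    unfolding induced_vimage_eq[OF A(2)]
    using A first_return_sets[OF A] by (intro emeasure_subadditive) auto
  also have "emeasure M (never_return \<inter> A) = 0"
    using emeasure_mono[of "never_return \<inter> A" never_return M] emeasure_never_return by simp
  also have "emeasure M (\<Union>k. first_return (Suc k) A) \<le> (\<Sum>k. emeasure M (first_return (Suc k) A))"
    using first_return_sets[OF A] by (intro emeasure_subadditive_countably) auto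
  also have "\<dots> \<le> emeasure M A"
    unfolding suminf_eq_SUP
  proof (rule SUP_least)
    show "(\<Sum>k<n. emeasure M (first_return (Suc k) A)) \<le> emeasure M A" for n
      by (subst emeasure_eq_sum_first_return[OF A, of n]) simp
  qed
  finally show ?thesis by simp
qed

lemma space_induced [simp]: "space m = Y"
  using Y_subset by (auto simp: induced_measure_def space_restrict_space)

lemma sets_induced: "A \<in> sets m \<longleftrightarrow> A \<in> sets M \<and> A \<subseteq> Y"
  using domain(1) Y_subset
  by (auto simp: induced_measure_def sets_restrict_space_iff Int_absorb2)

lemma emeasure_induced:
  assumes "A \<in> sets M" "A \<subseteq> Y"
  shows "emeasure m A = emeasure M A / emeasure M Y"
  using assms domain(1) Y_subset
  by (simp add: induced_measure_def sets_restrict_space_iff emeasure_restrict_space Int_absorb1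
      Int_absorb2)

lemma measure_induced:
  assumes "A \<in> sets M" "A \<subseteq> Y"
  shows "measure m A = measure M A / measure M Y"
proof -
  have "emeasure (restrict_space M Y) Y = emeasure M Y"
    using domain(1) Y_subset by (simp add: emeasure_restrict_space Int_absorb2)
  then show ?thesis
    using assms domain Y_subset
    by (simp add: induced_measure_def sets_restrict_space_iff measure_restrict_space Int_absorb1
        Int_absorb2)
qed

lemma prob_space_induced: "prob_space m"
proof (rule prob_spaceI)
  show "emeasure m (space m) = 1"
    using domain by (simp add: emeasure_induced ennreal_divide_self)
qed

lemma AE_induced_iff: "(AE x in m. P x) \<longleftrightarrow> (AE x in M. x \<in> Y \<longrightarrow> P x)"
proof -
  have "emeasure (restrict_space M Y) Y = emeasure M Y"
    using domain(1) Y_subset by (simp add: emeasure_restrict_space Int_absorb2)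
  then have "(AE x in m. P x) \<longleftrightarrow> (AE x in restrict_space M Y. x \<in> Y \<longrightarrow> P x)"
    using domain unfolding induced_measure_def by (intro AE_uniform_measure) auto
  also have "\<dots> \<longleftrightarrow> (AE x in M. x \<in> Y \<longrightarrow> P x)"
    using domain(1) Y_subset by (simp add: AE_restrict_space_iff Int_absorb2)
  finally show ?thesis .
qed

lemma measurable_induced_map: "T \<in> m \<rightarrow>\<^sub>M m"
proof (rule measurableI)
  fix A assume "A \<in> sets m"
  then have A: "A \<in> sets M" "A \<subseteq> Y" by (auto simp: sets_induced)
  have "(\<Union>k. first_return (Suc k) A) \<union> (never_return \<inter> A) \<in> sets M"
    using A first_return_sets[OF A] by auto
  then show "T -` A \<inter> space m \<in> sets m"
    using induced_vimage_eq[OF A(2)] by (auto simp: sets_induced)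
qed (simp add: induced_map_in)

lemma preserves_induced: "preserves_measure T m"
proof -
  interpret m: prob_space m by (rule prob_space_induced)
  have le: "m.prob (T -` A \<inter> Y) \<le> m.prob A" if "A \<in> sets m" for A
  proof -
    have A: "A \<in> sets M" "A \<subseteq> Y" using that by (auto simp: sets_induced)
    have B: "T -` A \<inter> Y \<in> sets M"
      using measurable_sets[OF measurable_induced_map that] by (simp add: sets_induced)
    have "emeasure m (T -` A \<inter> Y) \<le> emeasure m A"
      using emeasure_induced_vimage_le[OF A] A B
      by (simp add: emeasure_induced divide_right_mono_ennreal)
    then show ?thesis by (simp add: m.emeasure_eq_measure)
  qed
  have "distr m m T = m"
  proof (rule measure_eqI)
    fix A assume "A \<in> sets (distr m m T)"
    then have A: "A \<in> sets m" by simp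
    have TA: "T -` A \<inter> Y \<in> sets m"
      using measurable_sets[OF measurable_induced_map A] by simp
    have "T -` (Y - A) \<inter> Y = Y - (T -` A \<inter> Y)" using induced_map_in by auto
    then have "m.prob (Y - (T -` A \<inter> Y)) \<le> m.prob (Y - A)"
      using le[of "Y - A"] A sets.compl_sets[OF A] by simp
    then have "m.prob (T -` A \<inter> Y) = m.prob A"
      using le[OF A] m.prob_compl[OF A] m.prob_compl[OF TA] by simp
    then show "emeasure (distr m m T) A = emeasure m A"
      using A by (simp add: emeasure_distr[OF measurable_induced_map] m.emeasure_eq_measure)
  qed simp
  then show ?thesis using measurable_induced_map by (simp add: preserves_measure_def)
qed

lemma measurable_return_time: "R \<in> m \<rightarrow>\<^sub>M count_space UNIV"
proof (rule measurable_count_space_eq2_countable[THEN iffD2], intro conjI ballI)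
  fix k :: nat
  have "R -` {k} \<inter> Y \<in> sets M"
  proof (cases k)
    case 0
    then have "R -` {k} \<inter> Y = never_return" by (auto simp: never_return_def)
    then show ?thesis by simp
  next
    case (Suc i)
    have "R -` {k} \<inter> Y = first_return (Suc i) Y"
      using return_time_eq_iff[of "Suc i"] Suc by (auto simp: first_return_def)
    then show ?thesis using domain(1) by simp
  qed
  then show "R -` {k} \<inter> space m \<in> sets m" by (simp add: sets_induced)
qed auto

text \<open>The set of points with infinitely many visits is invariant, so it is null or conull. It is
  not null, because the last visit of a point of \<open>Y\<close> outside it lies in the null set of points
  that never return.\<close>
lemma AE_visits_infinitely_often:
  assumes ergodic: "ergodic f M"
  shows "AE x in M. \<forall>n. \<exists>k\<ge>n. (f ^^ k) x \<in> Y"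
proof -
  define E where "E = {x \<in> space M. \<forall>n. \<exists>k\<ge>n. (f ^^ k) x \<in> Y}"
  have E: "E \<in> sets M" using domain(1) unfolding E_def by measurable
  have "f -` E \<inter> space M = E"
  proof -
    have "f x \<in> space M" if "x \<in> space M" for x
      using preserving that by (auto simp: preserves_measure_def dest: measurable_space)
    moreover have "(\<forall>n. \<exists>k\<ge>n. (f ^^ k) (f x) \<in> Y) \<longleftrightarrow> (\<forall>n. \<exists>k\<ge>n. (f ^^ k) x \<in> Y)" for x
    proof
      assume *: "\<forall>n. \<exists>k\<ge>n. (f ^^ k) (f x) \<in> Y"
      show "\<forall>n. \<exists>k\<ge>n. (f ^^ k) x \<in> Y"
      proof
        fix n obtain k where "k \<ge> n" "(f ^^ k) (f x) \<in> Y" using * by blast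
        then show "\<exists>k\<ge>n. (f ^^ k) x \<in> Y" by (intro exI[of _ "Suc k"]) (simp add: funpow_swap1)
      qed
    next
      assume *: "\<forall>n. \<exists>k\<ge>n. (f ^^ k) x \<in> Y"
      show "\<forall>n. \<exists>k\<ge>n. (f ^^ k) (f x) \<in> Y"
      proof
        fix n obtain k where "k \<ge> Suc n" "(f ^^ k) x \<in> Y" using * by blast
        then show "\<exists>k\<ge>n. (f ^^ k) (f x) \<in> Y"
          by (intro exI[of _ "k - 1"]) (cases k, auto simp: funpow_swap1)
      qed
    qed
    ultimately show ?thesis unfolding E_def by auto
  qed
  then consider "emeasure M E = 0" | "emeasure M (space M - E) = 0"
    using ergodic E by (auto simp: ergodic_def)
  then show ?thesis
  proof cases
    case 1
    have "AE x in M. x \<notin> Y"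
      using AE_iterates[OF AE_not_never_return] AE_not_in[OF null_setsI[OF 1 E]] AE_space
    proof eventually_elim
      case (elim x)
      show "x \<notin> Y"
      proof
        assume "x \<in> Y"
        obtain n where n: "\<And>k. k \<ge> n \<Longrightarrow> (f ^^ k) x \<notin> Y"
          using elim by (auto simp: E_def)
        define K where "K = {k. (f ^^ k) x \<in> Y}"
        have "finite K" "0 \<in> K"
          using n \<open>x \<in> Y\<close> by (auto simp: K_def not_le[symmetric] intro!: finite_subset[of _ "{..<n}"])
        define k where "k = Max K"
        have "k \<in> K" using \<open>finite K\<close> \<open>0 \<in> K\<close> unfolding k_def by (intro Max_in) auto
        have "(f ^^ i) ((f ^^ k) x) \<notin> Y" if "i > 0" for i
        proof
          assume "(f ^^ i) ((f ^^ k) x) \<in> Y"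
          then have "i + k \<in> K" by (simp add: K_def funpow_add)
          then have "i + k \<le> k" unfolding k_def using \<open>finite K\<close> by (intro Max_ge)
          with that show False by simp
        qed
        then have "(f ^^ k) x \<in> never_return"
          using \<open>k \<in> K\<close> Y_subset by (auto simp: never_return_eq K_def)
        with elim show False by blast
      qed
    qed
    then have "emeasure M Y = 0" using domain(1) Y_subset
      by (subst (asm) AE_iff_measurable[of Y]) auto
    with domain(2) show ?thesis by simp
  next
    case 2
    then have "AE x in M. x \<notin> space M - E"
      using E by (intro AE_not_in null_setsI) auto
    then show ?thesis
      using AE_space by eventually_elim (auto simp: E_def)
  qed
qed

text \<open>Decompose \<open>Y\<close> by first returns in two ways: the rest after \<open>n\<close> levels is measured by the first
  entrance set on one side and by the return time tail on the other.\<close>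
lemma emeasure_first_entrance_le:
  "emeasure M (first_entrance n Y) \<le> emeasure M {x \<in> Y. real (R x) \<ge> real n}"
proof -
  have tail: "{x \<in> Y. real (R x) \<ge> real n} \<in> sets M"
  proof -
    have "{x \<in> space m. real (R x) \<ge> real n} \<in> sets m"
      using measurable_return_time by measurable
    then show ?thesis by (simp add: sets_induced)
  qed
  have "emeasure M Y \<le> emeasure M ((\<Union>k<n. first_return (Suc k) Y)
      \<union> ({x \<in> Y. real (R x) \<ge> real n} \<union> never_return))"
  proof (rule emeasure_mono)
    show "Y \<subseteq> (\<Union>k<n. first_return (Suc k) Y) \<union> ({x \<in> Y. real (R x) \<ge> real n} \<union> never_return)"
    proof
      fix x assume "x \<in> Y"
      show "x \<in> (\<Union>k<n. first_return (Suc k) Y) \<union> ({x \<in> Y. real (R x) \<ge> real n} \<union> never_return)"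
      proof (cases "R x")
        case 0 with \<open>x \<in> Y\<close> show ?thesis by (simp add: never_return_def)
      next
        case (Suc k)
        with \<open>x \<in> Y\<close> have "x \<in> first_return (Suc k) Y"
          using return_time_eq_iff[of "Suc k" x] by (auto simp: first_return_def)
        with Suc \<open>x \<in> Y\<close> show ?thesis by (cases "k < n") auto
      qed
    qed
  qed (use tail domain(1) in \<open>auto intro!: sets.finite_UN first_return_sets\<close>)
  also have "\<dots> \<le> emeasure M (\<Union>k<n. first_return (Suc k) Y)
      + (emeasure M {x \<in> Y. real (R x) \<ge> real n} + emeasure M never_return)"
    using tail domain(1)
    by (intro order_trans[OF emeasure_subadditive] add_left_mono emeasure_subadditive)
       (auto intro!: sets.finite_UN first_return_sets)
  also have "\<dots> \<le> (\<Sum>k<n. emeasure M (first_return (Suc k) Y))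
      + emeasure M {x \<in> Y. real (R x) \<ge> real n}"
    unfolding emeasure_never_return add_0_right using domain(1)
    by (intro add_right_mono emeasure_subadditive_finite) (auto intro!: first_return_sets)
  finally have le: "(\<Sum>k<n. emeasure M (first_return (Suc k) Y)) + emeasure M (first_entrance n Y)
      \<le> (\<Sum>k<n. emeasure M (first_return (Suc k) Y)) + emeasure M {x \<in> Y. real (R x) \<ge> real n}"
    by (subst (asm) emeasure_eq_sum_first_return[OF domain(1) order_refl, of n])
  define s where "s = (\<Sum>k<n. emeasure M (first_return (Suc k) Y))"
  have "s \<noteq> top"
    using emeasure_eq_sum_first_return[OF domain(1) order_refl, of n] domain(3)
    unfolding s_def[symmetric] by (auto simp: less_top)
  with le[folded s_def] show ?thesis by (simp add: ennreal_add_left_cancel_le)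
qed

text \<open>The half of Kac's formula that matters here: the first entrance sets cover almost the whole
  space, so infinite total measure forces a non-integrable return time.\<close>
lemma not_summable_return_tails:
  assumes ergodic: "ergodic f M" and infinite: "emeasure M (space M) = \<infinity>"
  shows "\<not> summable (\<lambda>n. measure m {x \<in> Y. real (R x) \<ge> real n})"
proof
  assume "summable (\<lambda>n. measure m {x \<in> Y. real (R x) \<ge> real n})"
  then have sm: "summable (\<lambda>n. measure M Y * measure m {x \<in> Y. real (R x) \<ge> real n})"
    by (rule summable_mult)
  have tail: "{x \<in> Y. real (R x) \<ge> real n} \<in> sets M" for n
  proof -
    have "{x \<in> space m. real (R x) \<ge> real n} \<in> sets m"
      using measurable_return_time by measurable
    then show ?thesis by (simp add: sets_induced)
  qed
  have Y0: "measure M Y > 0"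
    using domain by (simp add: measure_def enn2real_positive_iff less_top)
  have eq: "emeasure M {x \<in> Y. real (R x) \<ge> real n}
      = ennreal (measure M Y * measure m {x \<in> Y. real (R x) \<ge> real n})" for n
  proof -
    have "emeasure M {x \<in> Y. real (R x) \<ge> real n} \<le> emeasure M Y"
      using domain(1) by (intro emeasure_mono) auto
    then have "emeasure M {x \<in> Y. real (R x) \<ge> real n} < \<infinity>" using domain(3) by simp
    then show ?thesis
      using Y0 measure_induced[OF tail[of n]] by (simp add: emeasure_eq_ennreal_measure)
  qed
  have "AE x in M. x \<in> (\<Union>n. first_entrance n Y)"
    using AE_visits_infinitely_often[OF ergodic] AE_space
  proof eventually_elim
    case (elim x)
    then have ex: "\<exists>k. (f ^^ k) x \<in> Y" by blast
    define k where "k = (LEAST k. (f ^^ k) x \<in> Y)"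
    have "(f ^^ k) x \<in> Y" unfolding k_def using ex by (rule LeastI_ex)
    moreover have "(f ^^ j) x \<notin> Y" if "j < k" for j
      using not_less_Least that unfolding k_def by blast
    ultimately have "x \<in> first_entrance k Y" using elim by (simp add: first_entrance_def)
    then show ?case by blast
  qed
  then have "emeasure M (space M) \<le> emeasure M (\<Union>n. first_entrance n Y)"
    using domain(1) by (intro emeasure_mono_AE) auto
  also have "\<dots> \<le> (\<Sum>n. emeasure M (first_entrance n Y))"
    using domain(1) by (intro emeasure_subadditive_countably) auto
  also have "\<dots> \<le> (\<Sum>n. emeasure M {x \<in> Y. real (R x) \<ge> real n})"
    by (intro suminf_le emeasure_first_entrance_le) auto
  also have "\<dots> = ennreal (\<Sum>n. measure M Y * measure m {x \<in> Y. real (R x) \<ge> real n})"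
    unfolding eq by (intro suminf_ennreal_eq summable_sums sm) auto
  finally show False using infinite by (simp add: top_unique)
qed

end

section \<open>Growth of sums of a heavy-tailed observable\<close>

lemma powr_sum_le:
  fixes h :: "'b \<Rightarrow> real"
  assumes p: "p \<le> 1" and "finite S" and "\<And>j. j \<in> S \<Longrightarrow> h j \<ge> 0"
  shows "(\<Sum>j\<in>S. h j) powr p \<le> (\<Sum>j\<in>S. h j powr p)"
  using assms(2,3)
proof (induction S rule: finite_induct)
  case empty
  then show ?case by simp
next
  case (insert i S)
  have add: "(x + y) powr p \<le> x powr p + y powr p" if "x \<ge> 0" "y \<ge> 0" for x y :: real
  proof (cases "x = 0 \<or> y = 0")
    case False
    then have xy: "x > 0" "y > 0" using that by auto
    have split: "z powr p = z * z powr (p - 1)" if "z > 0" for z :: real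
      using that by (simp add: powr_diff)
    have "(x + y) powr (p - 1) \<le> x powr (p - 1)" "(x + y) powr (p - 1) \<le> y powr (p - 1)"
      using xy p by (auto intro!: powr_mono2')
    then have "x * (x + y) powr (p - 1) + y * (x + y) powr (p - 1)
        \<le> x * x powr (p - 1) + y * y powr (p - 1)"
      using xy by (intro add_mono mult_left_mono) auto
    then show ?thesis using xy by (simp add: split distrib_right)
  qed auto
  have "(\<Sum>j\<in>insert i S. h j) powr p \<le> h i powr p + (\<Sum>j\<in>S. h j) powr p"
    using insert by (auto intro!: add sum_nonneg)
  also have "\<dots> \<le> (\<Sum>j\<in>insert i S. h j powr p)"
    using insert by simp
  finally show ?case .
qed

text \<open>For \<open>p \<le> 1\<close> the power \<open>p\<close> of \<open>q\<close> is at most the sum of \<open>n\<close> to the power \<open>p - 1\<close> over \<open>1 \<le> n \<le> q\<close>,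
  since the summands decrease; integrating turns the indicator of \<open>n \<le> Q\<close> into the tail.\<close>
lemma nn_integral_moment_finite:
  fixes Q :: "'a \<Rightarrow> nat"
  assumes fin: "finite_measure m" and Q [measurable]: "Q \<in> m \<rightarrow>\<^sub>M count_space UNIV"
    and decay: "\<forall>\<^sub>F n in sequentially. measure m {x \<in> space m. Q x \<ge> n} \<le> real n powr (-b)"
    and p: "p < b" "p \<le> 1"
  shows "(\<integral>\<^sup>+x. ennreal (real (Q x) powr p) \<partial>m) < \<infinity>"
proof -
  interpret finite_measure m by (rule fin)
  define t where "t n = measure m {x \<in> space m. Q x \<ge> n}" for n
  have bound: "ennreal (real (Q x) powr p)
      \<le> (\<Sum>n. ennreal (real n powr (p - 1)) * indicator {x \<in> space m. Q x \<ge> n} x)"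
    (is "_ \<le> (\<Sum>n. ?h n)") if "x \<in> space m" for x
  proof -
    have "real (Q x) powr p \<le> (\<Sum>n\<in>{1..Q x}. real n powr (p - 1))"
    proof (cases "Q x = 0")
      case False
      have "real (Q x) powr p = (\<Sum>n\<in>{1..Q x}. real (Q x) powr (p - 1))"
        using False by (simp add: powr_diff)
      also have "\<dots> \<le> (\<Sum>n\<in>{1..Q x}. real n powr (p - 1))"
        using p by (intro sum_mono powr_mono2') auto
      finally show ?thesis .
    qed auto
    then have "ennreal (real (Q x) powr p) \<le> (\<Sum>n\<in>{1..Q x}. ennreal (real n powr (p - 1)))"
      by (simp add: sum_ennreal ennreal_leI)
    also have "\<dots> = (\<Sum>n\<in>{1..Q x}. ?h n)"
      using that by (intro sum.cong) auto
    also have "\<dots> \<le> (\<Sum>n. ?h n)"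
      by (intro sum_le_suminf) auto
    finally show ?thesis .
  qed
  have "(\<integral>\<^sup>+x. ennreal (real (Q x) powr p) \<partial>m)
      \<le> (\<integral>\<^sup>+x. (\<Sum>n. ennreal (real n powr (p - 1)) * indicator {x \<in> space m. Q x \<ge> n} x) \<partial>m)"
    using bound by (intro nn_integral_mono) auto
  also have "\<dots> = (\<Sum>n. \<integral>\<^sup>+x. ennreal (real n powr (p - 1)) * indicator {x \<in> space m. Q x \<ge> n} x \<partial>m)"
    by (intro nn_integral_suminf) measurable
  also have "\<dots> = (\<Sum>n. ennreal (real n powr (p - 1) * t n))"
    by (intro suminf_cong)
       (simp add: nn_integral_cmult_indicator emeasure_eq_measure t_def ennreal_mult)
  also have "summable (\<lambda>n. real n powr (p - 1) * t n)"
  proof (rule summable_comparison_test_ev)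
    show "summable (\<lambda>n. real n powr (p - 1 - b))"
      using p by (subst summable_real_powr_iff) auto
    show "\<forall>\<^sub>F n in sequentially. norm (real n powr (p - 1) * t n) \<le> real n powr (p - 1 - b)"
      using decay
    proof eventually_elim
      case (elim n)
      have "real n powr (p - 1) * t n \<le> real n powr (p - 1) * real n powr (-b)"
        using elim by (intro mult_left_mono) (auto simp: t_def)
      then show ?case by (simp add: t_def powr_add[symmetric])
    qed
  qed
  then have "(\<Sum>n. ennreal (real n powr (p - 1) * t n)) = ennreal (\<Sum>n. real n powr (p - 1) * t n)"
    by (intro suminf_ennreal_eq summable_sums) (auto simp: t_def)
  finally show ?thesis
    by (metis ennreal_less_top infinity_ennreal_def order.strict_trans1)
qed

text \<open>Without an integrable mean there is no ergodic theorem to use, but the moment of order \<open>p\<close> of a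
  sum of \<open>n\<close> terms is at most \<open>n\<close> times that of one term, without any independence.\<close>
lemma AE_eventually_birkhoff_sum_le:
  fixes Q :: "'a \<Rightarrow> nat"
  assumes prob: "prob_space m" and inv: "preserves_measure T m"
    and Q [measurable]: "Q \<in> m \<rightarrow>\<^sub>M count_space UNIV"
    and decay: "\<forall>\<^sub>F n in sequentially. measure m {x \<in> space m. Q x \<ge> n} \<le> real n powr (-b)"
    and p: "0 < p" "p < b" "p \<le> 1" and u: "u * p > 1"
  shows "AE x in m. \<forall>\<^sub>F n in sequentially. real (\<Sum>j<n. Q ((T ^^ j) x)) \<le> real n powr u"
proof -
  interpret prob_space m by (rule prob)
  have Tk [measurable]: "T ^^ k \<in> m \<rightarrow>\<^sub>M m" for k
    using preserves_measure_funpow[OF inv] by (simp add: preserves_measure_def)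
  have QT [measurable]: "(\<lambda>x. Q ((T ^^ k) x)) \<in> m \<rightarrow>\<^sub>M count_space UNIV" for k
    by (rule measurable_compose[OF Tk Q])
  define V where "V = (\<integral>\<^sup>+x. ennreal (real (Q x) powr p) \<partial>m)"
  have V: "V < \<infinity>"
    unfolding V_def using nn_integral_moment_finite[OF finite_measure_axioms Q decay p(2,3)] .
  have u0: "u > 0" using u p by (simp add: zero_less_mult_iff not_less[symmetric])
      (smt (verit) mult_nonneg_nonpos2)
  define S where "S n x = (\<Sum>j<n. Q ((T ^^ j) x))" for n x
  have S [measurable]: "S n \<in> m \<rightarrow>\<^sub>M count_space UNIV" for n
    unfolding S_def by measurable
  \<comment> \<open>The sum runs to \<open>2 * n\<close>, so that it dominates all sums of length between \<open>n\<close> and \<open>2 * n\<close>.\<close>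
  define E where "E n = {x \<in> space m. real n powr u < real (S (2 * n) x)}" for n
  have E: "E n \<in> sets m" for n unfolding E_def by measurable
  have "\<forall>\<^sub>F n in sequentially. measure m (E n) \<le> (2 * enn2real V) * real n powr (-(u * p - 1))"
    using eventually_gt_at_top[of 0]
  proof eventually_elim
    case (elim n)
    define c where "c = real n powr (- (u * p))"
    have "ennreal (measure m (E n)) = emeasure m (E n)" by (simp add: emeasure_eq_measure)
    also have "\<dots> \<le> emeasure m {x \<in> space m. 1 \<le> ennreal c * ennreal (real (S (2 * n) x) powr p)}"
    proof (rule emeasure_mono)
      show "E n \<subseteq> {x \<in> space m. 1 \<le> ennreal c * ennreal (real (S (2 * n) x) powr p)}"
      proof
        fix x assume x: "x \<in> E n"
        then have "(real n powr u) powr p \<le> real (S (2 * n) x) powr p"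
          using p by (intro powr_mono2) (auto simp: E_def)
        then have "1 \<le> c * real (S (2 * n) x) powr p"
          using elim by (simp add: c_def powr_powr powr_minus field_simps)
        then have "ennreal 1 \<le> ennreal (c * real (S (2 * n) x) powr p)" by (rule ennreal_leI)
        also have "\<dots> = ennreal c * ennreal (real (S (2 * n) x) powr p)"
          by (intro ennreal_mult) (auto simp: c_def)
        finally show "x \<in> {x \<in> space m. 1 \<le> ennreal c * ennreal (real (S (2 * n) x) powr p)}"
          using x by (simp add: E_def)
      qed
    qed measurable
    also have "\<dots> \<le> ennreal c * (\<integral>\<^sup>+x. ennreal (real (S (2 * n) x) powr p) * indicator (space m) x \<partial>m)"
      by (intro nn_integral_Markov_inequality) measurable
    also have "\<dots> = ennreal c * (\<integral>\<^sup>+x. ennreal (real (S (2 * n) x) powr p) \<partial>m)"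
      by (intro arg_cong2[where f = "(*)"] nn_integral_cong) auto
    also have "\<dots> \<le> ennreal c * (\<integral>\<^sup>+x. (\<Sum>j<2 * n. ennreal (real (Q ((T ^^ j) x)) powr p)) \<partial>m)"
    proof (intro mult_left_mono nn_integral_mono)
      fix x
      have "real (S (2 * n) x) powr p \<le> (\<Sum>j<2 * n. real (Q ((T ^^ j) x)) powr p)"
        unfolding S_def of_nat_sum using p by (intro powr_sum_le) auto
      then show "ennreal (real (S (2 * n) x) powr p)
          \<le> (\<Sum>j<2 * n. ennreal (real (Q ((T ^^ j) x)) powr p))"
        by (simp add: sum_ennreal ennreal_leI)
    qed auto
    also have "(\<integral>\<^sup>+x. (\<Sum>j<2 * n. ennreal (real (Q ((T ^^ j) x)) powr p)) \<partial>m)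
        = (\<Sum>j<2 * n. \<integral>\<^sup>+x. ennreal (real (Q ((T ^^ j) x)) powr p) \<partial>m)"
      by (intro nn_integral_sum) measurable
    also have "\<dots> = (\<Sum>j<2 * n. V)"
      unfolding V_def
      by (intro sum.cong refl nn_integral_funpow[OF inv, of "\<lambda>x. ennreal (real (Q x) powr p)"])
         measurable
    also have "ennreal c * \<dots> = ennreal (c * (2 * real n * enn2real V))"
      using V by (simp add: ennreal_mult c_def ennreal_of_nat_eq_real_of_nat ennreal_enn2real)
    finally have "measure m (E n) \<le> c * (2 * real n * enn2real V)"
      by (subst (asm) ennreal_le_iff) (auto simp: c_def)
    also have "\<dots> = 2 * enn2real V * (real n powr 1 * real n powr (- (u * p)))"
      using elim by (simp add: c_def)
    also have "\<dots> = 2 * enn2real V * real n powr (-(u * p - 1))"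
      unfolding powr_add[symmetric] by simp
    finally show ?case .
  qed
  then have "AE x in m. \<forall>\<^sub>F i in sequentially. x \<notin> E (2 ^ i)"
    using u E by (intro AE_eventually_avoids_dyadic[of m E "u * p - 1"]) (auto intro: finite_measure)
  then show ?thesis
    using AE_space
  proof eventually_elim
    case (elim x)
    show ?case
      using eventually_dyadic_bracket[OF elim(1)]
    proof eventually_elim
      case (elim n)
      then obtain k where k: "k > 0" "x \<notin> E k" "k \<le> n" "n < 2 * k" by blast
      have "real (S n x) \<le> real (S (2 * k) x)"
        unfolding S_def of_nat_le_iff using k by (intro sum_mono2) auto
      also have "\<dots> \<le> real k powr u" using k(2) \<open>x \<in> space m\<close> by (auto simp: E_def)
      also have "\<dots> \<le> real n powr u" using k u0 by (intro powr_mono2) auto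
      finally show ?case by (simp add: S_def)
    qed
  qed
qed

section \<open>Hitting exponents of the original map\<close>

text \<open>The logarithmic law without logarithms or infinite values. The second conjunct quantifies
  over all visits instead of the first, so it makes sense for orbits that never meet the target.
  For \<open>\<rho> = 0\<close> it still says something: with \<open>s < 0\<close> it excludes a visit at time \<open>0\<close>.\<close>
definition hits_at_rate :: "('a \<Rightarrow> 'a) \<Rightarrow> (nat \<Rightarrow> 'a set) \<Rightarrow> real \<Rightarrow> 'a \<Rightarrow> bool" where
  "hits_at_rate f B \<rho> x \<longleftrightarrow>
     (\<forall>u>\<rho>. \<forall>\<^sub>F n in sequentially. \<exists>k. real k \<le> real n powr u \<and> (f ^^ k) x \<in> B n) \<and>
     (\<forall>s<\<rho>. \<forall>\<^sub>F n in sequentially. \<forall>k. (f ^^ k) x \<in> B n \<longrightarrow> real n powr s \<le> real k)"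

lemma hitting_time_le: "(f ^^ k) x \<in> B \<Longrightarrow> hitting_time f x B \<le> enat k"
  unfolding hitting_time_def by (intro INF_lower) simp

lemma hitting_time_attained:
  assumes "hitting_time f x B = enat k"
  shows "(f ^^ k) x \<in> B"
proof -
  have ne: "{m. (f ^^ m) x \<in> B} \<noteq> {}"
  proof
    assume "{m. (f ^^ m) x \<in> B} = {}"
    then have "hitting_time f x B = \<infinity>"
      unfolding hitting_time_def by (simp add: top_enat_def)
    with assms show False by simp
  qed
  then have "hitting_time f x B \<in> enat ` {m. (f ^^ m) x \<in> B}"
    unfolding hitting_time_def Inf_enat_def by (auto intro: LeastI)
  with assms show ?thesis by auto
qed

lemma hits_at_rate_tendsto:
  assumes "hits_at_rate f B \<rho> x"
  shows "(\<lambda>n. ln_enat (hitting_time f x (B n)) / ereal (ln (real n))) \<longlonglongrightarrow> ereal \<rho>"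
proof (rule order_tendstoI)
  fix a assume "a < ereal \<rho>"
  then obtain s where s: "a < ereal s" "s < \<rho>"
    using ereal_dense2[OF \<open>a < ereal \<rho>\<close>] by auto
  have "\<forall>\<^sub>F n in sequentially. \<forall>k. (f ^^ k) x \<in> B n \<longrightarrow> real n powr s \<le> real k"
    using assms s by (auto simp: hits_at_rate_def)
  then show "\<forall>\<^sub>F n in sequentially. a < ln_enat (hitting_time f x (B n)) / ereal (ln (real n))"
    using eventually_gt_at_top[of 1]
  proof eventually_elim
    case (elim n)
    have n: "ln (real n) > 0" using elim by simp
    show ?case
    proof (cases "hitting_time f x (B n)")
      case infinity
      then have "ln_enat (hitting_time f x (B n)) / ereal (ln (real n)) = \<infinity>"
        using n by (simp add: ln_enat_def)
      then show ?thesis using less_le_trans[OF s(1), of \<infinity>] by simp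
    next
      case (enat k)
      then have le: "real n powr s \<le> real k" using elim(1) hitting_time_attained[OF enat] by blast
      have pos: "0 < real n powr s" using elim by simp
      with le have k: "k > 0" by (intro Nat.gr0I) auto
      have "s * ln (real n) = ln (real n powr s)" using elim by (simp add: ln_powr)
      also have "\<dots> \<le> ln (real k)" using le pos k by (subst ln_le_cancel_iff) auto
      finally have "s \<le> ln (real k) / ln (real n)" using n by (simp add: field_simps)
      then have "ereal s \<le> ln_enat (hitting_time f x (B n)) / ereal (ln (real n))"
        using n k enat by (simp add: ln_enat_def)
      with s(1) show ?thesis by (rule less_le_trans)
    qed
  qed
next
  fix a assume "ereal \<rho> < a"
  then obtain u where u: "ereal u < a" "\<rho> < u"
    using ereal_dense2[OF \<open>ereal \<rho> < a\<close>] by auto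
  have "\<forall>\<^sub>F n in sequentially. \<exists>k. real k \<le> real n powr u \<and> (f ^^ k) x \<in> B n"
    using assms u by (auto simp: hits_at_rate_def)
  then show "\<forall>\<^sub>F n in sequentially. ln_enat (hitting_time f x (B n)) / ereal (ln (real n)) < a"
    using eventually_gt_at_top[of 1]
  proof eventually_elim
    case (elim n)
    have n: "ln (real n) > 0" using elim by simp
    obtain j where j: "real j \<le> real n powr u" "(f ^^ j) x \<in> B n" using elim by blast
    obtain k where k: "hitting_time f x (B n) = enat k" "k \<le> j"
      using hitting_time_le[of j f x "B n"] j(2) by (cases "hitting_time f x (B n)") auto
    have "ln_enat (hitting_time f x (B n)) / ereal (ln (real n)) \<le> ereal u"
    proof (cases "k = 0")
      case True
      then show ?thesis using n k by (simp add: ln_enat_def)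
    next
      case False
      have "real k \<le> real n powr u" using j(1) k(2) by linarith
      then have "ln (real k) \<le> ln (real n powr u)"
        using False by (intro ln_mono) auto
      also have "\<dots> = u * ln (real n)" using elim by (simp add: ln_powr)
      finally have "ln (real k) / ln (real n) \<le> u" using n by (simp add: field_simps)
      then show ?thesis using n k False by (simp add: ln_enat_def)
    qed
    then show ?case using u(1) by (rule le_less_trans)
  qed
qed

text \<open>Before the first visit to \<open>Y\<close> no target can be met, so the two hitting times differ by the
  constant \<open>t\<close>.\<close>
lemma hits_at_rate_from_entrance:
  assumes rate: "hits_at_rate f B \<rho> ((f ^^ t) x)"
    and first: "\<And>j. j < t \<Longrightarrow> (f ^^ j) x \<notin> Y" and sub: "\<And>n. B n \<subseteq> Y" and \<rho>: "\<rho> \<ge> 0"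
  shows "hits_at_rate f B \<rho> x"
  unfolding hits_at_rate_def
proof (intro conjI allI impI)
  fix u assume "u > \<rho>"
  then obtain v where v: "\<rho> < v" "v < u" using dense by blast
  have "\<forall>\<^sub>F n in sequentially. \<exists>k. real k \<le> real n powr v \<and> (f ^^ k) ((f ^^ t) x) \<in> B n"
    using rate v by (auto simp: hits_at_rate_def)
  moreover have "\<forall>\<^sub>F n in sequentially. real n powr v + real t \<le> real n powr u"
    using v \<rho> by real_asymp
  ultimately show "\<forall>\<^sub>F n in sequentially. \<exists>k. real k \<le> real n powr u \<and> (f ^^ k) x \<in> B n"
  proof eventually_elim
    case (elim n)
    then obtain k where "real k \<le> real n powr v" "(f ^^ k) ((f ^^ t) x) \<in> B n" by blast
    with elim show ?case by (intro exI[of _ "k + t"]) (auto simp: funpow_add)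
  qed
next
  fix s assume "s < \<rho>"
  then have "\<forall>\<^sub>F n in sequentially. \<forall>k. (f ^^ k) ((f ^^ t) x) \<in> B n \<longrightarrow> real n powr s \<le> real k"
    using rate by (auto simp: hits_at_rate_def)
  then show "\<forall>\<^sub>F n in sequentially. \<forall>k. (f ^^ k) x \<in> B n \<longrightarrow> real n powr s \<le> real k"
  proof eventually_elim
    case (elim n)
    show ?case
    proof (intro allI impI)
      fix k assume k: "(f ^^ k) x \<in> B n"
      with first sub have "t \<le> k" by (meson not_less subsetD)
      then have "(f ^^ (k - t)) ((f ^^ t) x) = (f ^^ k) x"
        by (metis comp_apply funpow_add le_add_diff_inverse2)
      with elim k have "real n powr s \<le> real (k - t)" by metis
      then show "real n powr s \<le> real k" by simp
    qed
  qed
qed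

context recurrent_domain
begin

text \<open>The \<open>f\<close>-time that passes during the first \<open>k\<close> steps of the induced map.\<close>
definition clock :: "nat \<Rightarrow> 'a \<Rightarrow> nat" where
  "clock k x = (\<Sum>j<k. R ((T ^^ j) x))"

lemma iterate_clock: "(f ^^ clock k x) x = (T ^^ k) x"
proof (induction k)
  case 0
  then show ?case by (simp add: clock_def)
next
  case (Suc k)
  have "clock (Suc k) x = R ((T ^^ k) x) + clock k x" by (simp add: clock_def)
  then have "(f ^^ clock (Suc k) x) x
      = (f ^^ R ((T ^^ k) x)) ((f ^^ clock k x) x)"
    by (simp add: funpow_add)
  also have "\<dots> = T ((T ^^ k) x)" unfolding Suc by (simp only: induced_map_def)
  finally show ?case by simp
qed

lemma clock_Suc: "clock (Suc k) x = R x + clock k (T x)"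
  unfolding clock_def by (simp add: sum.lessThan_Suc_shift funpow_swap1 del: sum.lessThan_Suc)

text \<open>The induced map skips no visit to \<open>Y\<close>. Hence every visit of \<open>f\<close> to a target is seen by the
  induced map.\<close>
lemma visit_is_clock:
  assumes "x \<in> Y" "(f ^^ k) x \<in> Y"
  shows "\<exists>j. k = clock j x"
  using assms
proof (induction k arbitrary: x rule: less_induct)
  case (less k)
  show ?case
  proof (cases "k = 0")
    case True
    then show ?thesis by (intro exI[of _ 0]) (simp add: clock_def)
  next
    case False
    with less.prems have R: "0 < R x" "R x \<le> k" using return_time_le[of k x] by auto
    then have "(f ^^ (k - R x)) (T x) = (f ^^ k) x"
      unfolding induced_map_def by (metis comp_apply funpow_add le_add_diff_inverse2)
    with less.prems have "(f ^^ (k - R x)) (T x) \<in> Y" by simp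
    then obtain j where "k - R x = clock j (T x)"
      using less.IH[of "k - R x" "T x"] R induced_map_in less.prems by auto
    then show ?thesis using R by (intro exI[of _ "Suc j"]) (simp add: clock_Suc)
  qed
qed

lemma clock_mono: "i \<le> j \<Longrightarrow> clock i x \<le> clock j x"
  unfolding clock_def by (intro sum_mono2) auto

lemma return_time_le_clock: "i < j \<Longrightarrow> R ((T ^^ i) x) \<le> clock j x"
  unfolding clock_def by (intro member_le_sum) auto

text \<open>Composition of the two exponents, for a single orbit. For the upper bound, the visit at induced
  time \<open>k\<close> is at time \<open>clock k x\<close>. For the lower bound, a visit comes after more than \<open>i\<close> induced
  steps, where \<open>i\<close> is an index with a long excursion, and the clock contains that excursion.\<close>
lemma hits_at_rate_of_induced:
  assumes x: "x \<in> Y" and sub: "\<And>n. B n \<subseteq> Y" and a: "a \<ge> 0" and r: "r > 0"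
    and late: "\<And>b. b > a \<Longrightarrow> \<forall>\<^sub>F n in sequentially. \<exists>k. real k \<le> real n powr b \<and> (T ^^ k) x \<in> B n"
    and early: "\<And>s. s < a \<Longrightarrow> \<forall>\<^sub>F n in sequentially. \<forall>k. real k < real n powr s \<longrightarrow> (T ^^ k) x \<notin> B n"
    and leaves: "\<forall>\<^sub>F n in sequentially. x \<notin> B n"
    and slow: "\<And>u. u > 1 / r \<Longrightarrow> \<forall>\<^sub>F n in sequentially. real (clock n x) \<le> real n powr u"
    and long: "\<And>b. b > r \<Longrightarrow>
      \<forall>\<^sub>F n in sequentially. \<exists>k. real k \<le> real n powr b \<and> n \<le> R ((T ^^ k) x)"
  shows "hits_at_rate f B (a / r) x"
  unfolding hits_at_rate_def
proof (intro conjI allI impI)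
  fix u assume u: "u > a / r"
  \<comment> \<open>The product of exponents is continuous, so both factors can be enlarged slightly.\<close>
  have "((\<lambda>e. (a + e) * (1 / r + e)) \<longlongrightarrow> a / r) (at_right 0)"
    using r by (auto intro!: tendsto_eq_intros)
  from order_tendstoD(2)[OF this u] have "\<forall>\<^sub>F e in at_right 0. (a + e) * (1 / r + e) < u \<and> e > 0"
    by (intro eventually_conj eventually_at_right_less)
  then obtain e where e: "(a + e) * (1 / r + e) < u" "e > 0"
    using eventually_happens'[OF trivial_limit_at_right_real] by blast
  define b v where "b = a + e" and "v = 1 / r + e"
  have b: "b > a" "b > 0" and v: "v > 1 / r" "v > 0" and bv: "b * v < u"
    using e a r by (auto simp: b_def v_def add_pos_pos)
  have lim: "filterlim (\<lambda>n. nat \<lceil>real n powr b\<rceil>) at_top sequentially"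
  proof -
    have "filterlim (\<lambda>n. real n powr b) at_top sequentially" using b(2) by real_asymp
    then show ?thesis
      unfolding filterlim_sequentially_iff_filterlim_real
      by (rule filterlim_at_top_mono) (intro always_eventually allI real_nat_ceiling_ge)
  qed
  define d where "d = u - b * v"
  have "d > 0" using bv by (simp add: d_def)
  then have large: "\<forall>\<^sub>F n in sequentially. 2 powr v \<le> real n powr d" by real_asymp
  show "\<forall>\<^sub>F n in sequentially. \<exists>k. real k \<le> real n powr u \<and> (f ^^ k) x \<in> B n"
    using late[OF b(1)] eventually_compose_filterlim[OF slow[OF v(1)] lim] large
      eventually_ge_at_top[of 1]
  proof eventually_elim
    case (elim n)
    define K where "K = nat \<lceil>real n powr b\<rceil>"
    obtain k where k: "real k \<le> real n powr b" "(T ^^ k) x \<in> B n" using elim by blast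
    have "1 \<le> real n powr b" using elim b by (intro ge_one_powr_ge_zero) auto
    then have K: "real K \<le> 2 * real n powr b" and "k \<le> K" using k unfolding K_def by linarith+
    have "real (clock k x) \<le> real (clock K x)" using clock_mono[OF \<open>k \<le> K\<close>] by simp
    also have "\<dots> \<le> real K powr v" using elim by (simp add: K_def)
    also have "\<dots> \<le> (2 * real n powr b) powr v" using K v by (intro powr_mono2) auto
    also have "\<dots> = 2 powr v * real n powr (b * v)"
      by (subst powr_mult) (auto simp: powr_powr)
    also have "\<dots> \<le> real n powr d * real n powr (b * v)"
      using elim by (intro mult_right_mono) auto
    also have "\<dots> = real n powr u" by (simp add: powr_add[symmetric] d_def)
    finally show ?case using k(2) by (intro exI[of _ "clock k x"]) (simp add: iterate_clock)
  qed
next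
  fix s assume s: "s < a / r"
  show "\<forall>\<^sub>F n in sequentially. \<forall>k. (f ^^ k) x \<in> B n \<longrightarrow> real n powr s \<le> real k"
  proof (cases "s < 0")
    case True
    show ?thesis
      using leaves eventually_ge_at_top[of 1]
    proof eventually_elim
      case (elim n)
      show ?case
      proof (intro allI impI)
        fix k assume "(f ^^ k) x \<in> B n"
        with elim have "k \<noteq> 0" by (intro notI) auto
        moreover have "real n powr s \<le> real n powr 0" using elim True by (intro powr_mono) auto
        ultimately show "real n powr s \<le> real k" using elim by simp
      qed
    qed
  next
    case False
    \<comment> \<open>The scale \<open>N\<close> below is \<open>n\<close> to the power \<open>s + e\<close>. An excursion of length \<open>N\<close> occurs before
        induced time \<open>N\<close> to the power \<open>r + e\<close>, which must precede \<open>n\<close> to the power \<open>a - e\<close>.\<close>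
    have "((\<lambda>e. (s + e) * (r + e) - (a - e)) \<longlongrightarrow> s * r - a) (at_right 0)"
      by (auto intro!: tendsto_eq_intros)
    moreover have "s * r - a < 0" using s r by (simp add: field_simps)
    ultimately have "\<forall>\<^sub>F e in at_right 0. (s + e) * (r + e) - (a - e) < 0 \<and> e > 0"
      by (intro eventually_conj eventually_at_right_less order_tendstoD(2)) auto
    then obtain e where "(s + e) * (r + e) - (a - e) < 0" "e > 0"
      using eventually_happens'[OF trivial_limit_at_right_real] by blast
    then have e: "(s + e) * (r + e) < a - e" "e > 0" by auto
    define \<sigma> b where "\<sigma> = s + e" and "b = r + e"
    have \<sigma>: "\<sigma> > s" "\<sigma> > 0" and b: "b > r" "b > 0" using e False r by (auto simp: \<sigma>_def b_def)
    have lim: "filterlim (\<lambda>n. nat \<lfloor>real n powr \<sigma>\<rfloor>) at_top sequentially"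
    proof -
      have "filterlim (\<lambda>n. real n powr \<sigma> - 1) at_top sequentially"
        using \<sigma>(2) by real_asymp
      moreover have "real n powr \<sigma> - 1 \<le> real (nat \<lfloor>real n powr \<sigma>\<rfloor>)" for n
        by linarith
      ultimately show ?thesis
        unfolding filterlim_sequentially_iff_filterlim_real
        by (elim filterlim_at_top_mono) (intro always_eventually allI)
    qed
    have early': "\<forall>\<^sub>F n in sequentially. \<forall>k. real k < real n powr (a - e) \<longrightarrow> (T ^^ k) x \<notin> B n"
      using e by (intro early) auto
    have gap: "\<forall>\<^sub>F n in sequentially. real n powr s + 1 \<le> real n powr \<sigma>"
    proof -
      have "\<forall>\<^sub>F n in sequentially. 2 \<le> real n powr e" using e(2) by real_asymp
      then show ?thesis
        using eventually_ge_at_top[of 1]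
      proof eventually_elim
        case (elim n)
        have "1 \<le> real n powr s" using elim False by (intro ge_one_powr_ge_zero) auto
        then have "real n powr s + 1 \<le> real n powr s * 2" by simp
        also have "\<dots> \<le> real n powr s * real n powr e" using elim by (intro mult_left_mono) auto
        finally show ?case by (simp add: \<sigma>_def powr_add)
      qed
    qed
    show ?thesis
      using early' eventually_compose_filterlim[OF long[OF b(1)] lim] gap
        eventually_gt_at_top[of 1]
    proof eventually_elim
      case (elim n)
      define N where "N = nat \<lfloor>real n powr \<sigma>\<rfloor>"
      obtain i where i: "real i \<le> real N powr b" "N \<le> R ((T ^^ i) x)"
        using elim by (auto simp: N_def)
      have "real N \<le> real n powr \<sigma>" unfolding N_def by simp
      then have "real N powr b \<le> (real n powr \<sigma>) powr b" using b by (intro powr_mono2) auto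
      also have "\<dots> < real n powr (a - e)"
        using e elim by (simp add: powr_powr \<sigma>_def b_def)
      finally have i_less: "real i < real n powr (a - e)" using i by simp
      show ?case
      proof (intro allI impI)
        fix k assume k: "(f ^^ k) x \<in> B n"
        then obtain j where j: "k = clock j x" using visit_is_clock[OF x] sub by blast
        then have "(T ^^ j) x \<in> B n" using k by (simp add: iterate_clock)
        with elim have "real n powr (a - e) \<le> real j" by (meson not_less)
        with i_less have "i < j" by simp
        then have "N \<le> k" using return_time_le_clock[of i j x] i j by simp
        moreover have "real n powr s \<le> real N" using elim unfolding N_def by linarith
        ultimately show "real n powr s \<le> real k" by simp
      qed
    qed
  qed
qed

lemma regular_decay_induced:
  assumes sub: "\<And>n. B n \<subseteq> Y" and meas: "\<And>n. n \<ge> 1 \<Longrightarrow> B n \<in> sets M"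
    and reg: "regular_decay M B \<alpha>"
  shows "regular_decay m B \<alpha>"
proof -
  define v where "v = measure M Y"
  have v: "v > 0"
    using domain by (simp add: v_def measure_def enn2real_positive_iff less_top)
  have eq: "measure m (B n) = measure M (B n) / v" if "n \<ge> 1" for n
    unfolding v_def using measure_induced[OF meas[OF that] sub] .
  have ev: "\<forall>\<^sub>F n in sequentially. measure m (B n) = measure M (B n) / v"
    using eventually_ge_at_top[of 1] by eventually_elim (rule eq)
  from reg obtain c where lim0: "(\<lambda>n. measure M (B n)) \<longlonglongrightarrow> 0"
    and c: "c > 0" "\<forall>\<^sub>F n in sequentially. measure M (B (Suc n)) > c * measure M (B n)"
    and \<alpha>: "\<alpha> \<ge> 0" "(\<lambda>n. ln (measure M (B n)) / (- ln (real n))) \<longlonglongrightarrow> \<alpha>"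
    by (auto simp: regular_decay_def)
  show ?thesis
    unfolding regular_decay_def
  proof (intro conjI)
    have "(\<lambda>n. measure M (B n) / v) \<longlonglongrightarrow> 0 / v"
      using v by (intro tendsto_divide lim0 tendsto_const) auto
    then show "(\<lambda>n. measure m (B n)) \<longlonglongrightarrow> 0"
      using ev by (subst tendsto_cong[OF ev]) simp
    have "\<forall>\<^sub>F n in sequentially. measure m (B (Suc n)) > c * measure m (B n)"
      using c(2) eventually_ge_at_top[of 1]
      by eventually_elim (use v in \<open>simp add: eq divide_strict_right_mono\<close>)
    then show "\<exists>c>0. \<forall>\<^sub>F n in sequentially. measure m (B (Suc n)) > c * measure m (B n)"
      using c(1) by blast
    show "\<alpha> \<ge> 0" by fact
    have "(\<lambda>n. ln v / ln (real n)) \<longlonglongrightarrow> 0" by real_asymp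
    from tendsto_add[OF \<alpha>(2) this]
    have "(\<lambda>n. ln (measure M (B n)) / (- ln (real n)) + ln v / ln (real n)) \<longlonglongrightarrow> \<alpha>" by simp
    moreover have ln_eq: "\<forall>\<^sub>F n in sequentially. ln (measure m (B n)) / (- ln (real n))
        = ln (measure M (B n)) / (- ln (real n)) + ln v / ln (real n)"
      using ev regular_decay_pos[OF reg] eventually_gt_at_top[of 1]
    proof eventually_elim
      case (elim n)
      then have "ln (measure m (B n)) = ln (measure M (B n)) - ln v"
        using v by (simp add: ln_div)
      then show ?case by (simp add: diff_divide_distrib)
    qed
    ultimately show "(\<lambda>n. ln (measure m (B n)) / (- ln (real n))) \<longlonglongrightarrow> \<alpha>"
      by (subst tendsto_cong[OF ln_eq])
  qed
qed

end

section \<open>The hitting time law\<close>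

theorem proposition2p10:
  fixes f :: "'a::metric_space \<Rightarrow> 'a"
    and M :: "'a measure"
    and Y :: "'a set"
    and B :: "nat \<Rightarrow> 'a set"
    and \<alpha> \<alpha>\<^sub>R :: real
  assumes borel: "sets borel \<subseteq> sets M"
    and sigma_finite: "sigma_finite_measure M"
    and infinite: "emeasure M (space M) = \<infinity>"
    and preserving: "preserves_measure f M"
    and conservative: "conservative f M"
    and ergodic: "ergodic f M"
    and domain: "Y \<in> sets M" "0 < emeasure M Y" "emeasure M Y < \<infinity>"
    and return_time:
      "regular_suplevels (induced_measure M Y) (\<lambda>x. real (return_time f Y x)) \<alpha>\<^sub>R"
    and exponent: "\<alpha>\<^sub>R > 0"
    and mixing: "SPDC (induced_map f Y) (induced_measure M Y)"
    and targets: "\<And>n. B n \<subseteq> Y" "decseq B"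
      "regular_decay M B \<alpha>" "lipschitz_sublevels M Y B"
  shows "AE x in M.
    (\<lambda>n. ln_enat (hitting_time f x (B n)) / ereal (ln (real n))) \<longlonglongrightarrow> ereal (\<alpha> / \<alpha>\<^sub>R)"
proof -
  interpret recurrent_domain f M Y
    by unfold_locales fact+
  note prob = prob_space_induced and inv = preserves_induced
  have \<alpha>0: "\<alpha> \<ge> 0" using targets(3) by (simp add: regular_decay_def)
  have cont: "h \<in> borel_measurable m" if h: "continuous_on (space m) h" for h :: "'a \<Rightarrow> real"
  proof (rule borel_measurableI)
    fix S :: "real set" assume "open S"
    then obtain U where U: "open U" "U \<inter> Y = h -` S \<inter> Y"
      using h unfolding continuous_on_open_invariant by auto
    have "U \<in> sets M" using borel U(1) borel_open by blast
    then show "h -` S \<inter> space m \<in> sets m"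
      using U(2) domain(1) by (simp add: sets_induced flip: U(2))
  qed
  define A where "A n = {x \<in> Y. real (R x) \<ge> real n}" for n
  have A_reg: "regular_decay m A \<alpha>\<^sub>R" and A_lip: "lipschitz_sublevels m (space m) A"
    using return_time by (simp_all add: regular_suplevels_def Let_def A_def[abs_def])
  have A_sets: "A n \<in> sets m" for n
  proof -
    have "{x \<in> space m. real (R x) \<ge> real n} \<in> sets m"
      using measurable_return_time by measurable
    then show ?thesis by (simp add: A_def)
  qed
  have A_dec: "A k \<subseteq> A n" if "n \<le> k" for n k using that by (auto simp: A_def)
  have B_sets: "B n \<in> sets m" if "n \<ge> 1" for n
    using lipschitz_sublevels_sets[OF targets(4) that cont] by simp
  then have B_sets_M: "B n \<in> sets M" if "n \<ge> 1" for n using that by (simp add: sets_induced)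
  have B_dec: "B k \<subseteq> B n" if "n \<le> k" for n k using targets(2) that by (auto dest: decseqD)
  have B_reg: "regular_decay m B \<alpha>"
    using regular_decay_induced[OF targets(1) B_sets_M targets(3)] .
  have "measure M Y > 0"
    using domain by (simp add: measure_def enn2real_positive_iff less_top)
  then have B_lip: "lipschitz_sublevels m (space m) B"
    using lipschitz_sublevels_rescale[OF targets(4), of "measure M Y" m]
      measure_induced[OF B_sets_M targets(1)] by simp
  \<comment> \<open>A larger exponent would make the return time integrable and the total measure finite.\<close>
  have "\<alpha>\<^sub>R \<le> 1"
  proof (rule ccontr)
    assume "\<not> \<alpha>\<^sub>R \<le> 1"
    then obtain b where b: "1 < b" "b < \<alpha>\<^sub>R" using dense[of 1 \<alpha>\<^sub>R] by auto
    have "summable (\<lambda>n. real n powr (-b))" using b by (subst summable_real_powr_iff) auto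
    then have "summable (\<lambda>n. measure m (A n))"
      by (rule summable_comparison_test_ev[rotated])
         (use regular_decay_bounds(1)[OF A_reg b(2)] in simp)
    then show False using not_summable_return_tails[OF ergodic infinite] by (simp add: A_def)
  qed
  have late: "AE x in m. \<forall>b>\<alpha>. \<forall>\<^sub>F n in sequentially.
      \<exists>k. real k \<le> real n powr b \<and> (T ^^ k) x \<in> B n"
  proof (rule AE_all_greater)
    show "AE x in m. \<forall>\<^sub>F n in sequentially. \<exists>k. real k \<le> real n powr b \<and> (T ^^ k) x \<in> B n"
      if "b > \<alpha>" for b
      using that by (intro AE_eventually_hit[OF prob inv cont B_sets B_dec B_reg B_lip mixing])
    show "\<forall>\<^sub>F n in sequentially. \<exists>k. real k \<le> real n powr c \<and> (T ^^ k) x \<in> B n"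
      if "\<forall>\<^sub>F n in sequentially. \<exists>k. real k \<le> real n powr b \<and> (T ^^ k) x \<in> B n" "b \<le> c" for b c x
      using that(1) eventually_powr_mono[OF that(2)]
      by eventually_elim (auto intro: order_trans)
  qed
  have leaves: "AE x in m. \<forall>\<^sub>F n in sequentially. x \<notin> B n"
    using B_reg by (intro AE_eventually_leaves[OF prob B_sets B_dec]) (auto simp: regular_decay_def)
  have early: "AE x in m. \<forall>s<\<alpha>. \<forall>\<^sub>F n in sequentially.
      \<forall>k. real k < real n powr s \<longrightarrow> (T ^^ k) x \<notin> B n"
  proof (rule AE_all_less)
    show "AE x in m. \<forall>\<^sub>F n in sequentially. \<forall>k. real k < real n powr s \<longrightarrow> (T ^^ k) x \<notin> B n"
      if s: "s < \<alpha>" for s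
    proof (cases "s \<ge> 0")
      case True
      obtain b where "s < b" "b < \<alpha>" using dense[OF s] by blast
      then show ?thesis
        using regular_decay_bounds(1)[OF B_reg] True
        by (intro AE_eventually_no_early_hit[OF prob inv B_sets B_dec]) auto
    next
      case False
      show ?thesis
        using leaves
      proof eventually_elim
        case (elim x)
        show ?case
          using elim eventually_ge_at_top[of 1]
        proof eventually_elim
          case (elim n)
          have "real n powr s \<le> real n powr 0" using elim False by (intro powr_mono) auto
          with elim have "k = 0" if "real k < real n powr s" for k using that by simp
          with elim show ?case by fastforce
        qed
      qed
    qed
    show "\<forall>\<^sub>F n in sequentially. \<forall>k. real k < real n powr b \<longrightarrow> (T ^^ k) x \<notin> B n"
      if "\<forall>\<^sub>F n in sequentially. \<forall>k. real k < real n powr c \<longrightarrow> (T ^^ k) x \<notin> B n" "b \<le> c" for b c x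
      using that(1) eventually_powr_mono[OF that(2)]
      by eventually_elim (auto intro: less_le_trans)
  qed
  have slow: "AE x in m. \<forall>u>1 / \<alpha>\<^sub>R. \<forall>\<^sub>F n in sequentially. real (clock n x) \<le> real n powr u"
  proof (rule AE_all_greater)
    fix u assume u: "u > 1 / \<alpha>\<^sub>R"
    then have u0: "u > 0" using exponent by (meson less_trans zero_less_divide_1_iff)
    then have "1 / u < \<alpha>\<^sub>R" using u exponent by (simp add: field_simps)
    \<comment> \<open>The order of the moment must exceed \<open>1 / u\<close> for summability and stay below \<open>\<alpha>\<^sub>R\<close> for finiteness.\<close>
    then obtain p where p: "1 / u < p" "p < \<alpha>\<^sub>R" using dense by blast
    obtain b where b: "p < b" "b < \<alpha>\<^sub>R" using dense[OF p(2)] by blast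
    have "0 < 1 / u" using u0 by simp
    then have p': "0 < p" "u * p > 1" using p(1) u0 by (linarith, simp add: field_simps)
    have "\<forall>\<^sub>F n in sequentially. measure m {x \<in> space m. n \<le> R x} \<le> real n powr (-b)"
      using regular_decay_bounds(1)[OF A_reg b(2)] by (simp add: A_def)
    from AE_eventually_birkhoff_sum_le[OF prob inv measurable_return_time this p'(1) b(1) _ p'(2)]
    show "AE x in m. \<forall>\<^sub>F n in sequentially. real (clock n x) \<le> real n powr u"
      using p(2) \<open>\<alpha>\<^sub>R \<le> 1\<close> by (simp add: clock_def)
  next
    show "\<forall>\<^sub>F n in sequentially. real (clock n x) \<le> real n powr c"
      if "\<forall>\<^sub>F n in sequentially. real (clock n x) \<le> real n powr b" "b \<le> c" for b c x
      using that(1) eventually_powr_mono[OF that(2)]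
      by eventually_elim (auto intro: order_trans)
  qed
  have long: "AE x in m. \<forall>b>\<alpha>\<^sub>R. \<forall>\<^sub>F n in sequentially.
      \<exists>k. real k \<le> real n powr b \<and> n \<le> R ((T ^^ k) x)"
  proof (rule AE_all_greater)
    fix b assume "b > \<alpha>\<^sub>R"
    from AE_eventually_hit[OF prob inv cont A_sets A_dec A_reg A_lip mixing this]
    show "AE x in m. \<forall>\<^sub>F n in sequentially. \<exists>k. real k \<le> real n powr b \<and> n \<le> R ((T ^^ k) x)"
      by (auto simp: A_def elim!: eventually_mono)
  next
    show "\<forall>\<^sub>F n in sequentially. \<exists>k. real k \<le> real n powr c \<and> n \<le> R ((T ^^ k) x)"
      if "\<forall>\<^sub>F n in sequentially. \<exists>k. real k \<le> real n powr b \<and> n \<le> R ((T ^^ k) x)" "b \<le> c" for b c x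
      using that(1) eventually_powr_mono[OF that(2)]
      by eventually_elim (auto intro: order_trans)
  qed
  have "AE x in m. hits_at_rate f B (\<alpha> / \<alpha>\<^sub>R) x"
    using late leaves early slow long AE_space
  proof eventually_elim
    case (elim x)
    then have "x \<in> Y" by simp
    then show ?case
      by (rule hits_at_rate_of_induced[OF _ targets(1) \<alpha>0 exponent]) (use elim in blast)+
  qed
  then have "AE x in M. x \<in> Y \<longrightarrow> hits_at_rate f B (\<alpha> / \<alpha>\<^sub>R) x"
    by (simp add: AE_induced_iff)
  from AE_iterates[OF this] AE_visits_infinitely_often[OF ergodic] show ?thesis
  proof eventually_elim
    case (elim x)
    then have ex: "\<exists>t. (f ^^ t) x \<in> Y" by blast
    define t where "t = (LEAST t. (f ^^ t) x \<in> Y)"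
    have t: "(f ^^ t) x \<in> Y" unfolding t_def using ex by (rule LeastI_ex)
    have first: "(f ^^ j) x \<notin> Y" if "j < t" for j
      using not_less_Least that unfolding t_def by blast
    have "hits_at_rate f B (\<alpha> / \<alpha>\<^sub>R) ((f ^^ t) x)" using elim(1) t by blast
    then have "hits_at_rate f B (\<alpha> / \<alpha>\<^sub>R) x"
      by (rule hits_at_rate_from_entrance[OF _ first targets(1)]) (use \<alpha>0 exponent in \<open>auto intro: divide_nonneg_pos\<close>)
    then show ?case by (rule hits_at_rate_tendsto)
  qed
qed

end
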